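(* Let $\mathcal{P}$ be a Poisson algebra over an arbitrary field $K$. Then the following statements are equivalent: (1) The Poisson enveloping algebra $\mathcal{U}(\mathcal{P})$ is a simple algebra. (2) The algebra $P\mathcal{D}(\mathcal{P})$ is a simple algebra and $\mathcal{U}(\mathcal{P})\simeq P\mathcal{D}(\mathcal{P})$. (3) The Poisson algebra $\mathcal{P}$ is a Poisson simple algebra and $\mathcal{P}$ is a faithful left $\mathcal{U}(\mathcal{P})$-module. If one of the equivalent conditions holds then $\mathcal{U}(\mathcal{P})\simeq P\mathcal{D}(\mathcal{P})$.
   Context: A Poisson algebra over $K$ is a commutative associative (unital) $K$-algebra $\mathcal{P}$ with a $K$-bilinear Lie bracket $\{\cdot,\cdot\}$ such that $\{a,xy\}=\{a,x\}y+x\{a,y\}$ for all $a,x,y\in\mathcal{P}$. A Poisson ideal is an ideal $J$ with $\{\mathcal{P},J\}\subseteq J$; $\mathcal{P}$ is Poisson simple if $0$ and $\mathcal{P}$ are its only Poisson ideals. The Poisson enveloping algebra of $\mathcal{P}$ is the universal triple $(\mathcal{U}(\mathcal{P}),\alpha,\beta)$, where $\mathcal{U}(\mathcal{P})$ is an associative algebra, $\alpha:\mathcal{P}\to\mathcal{U}(\mathcal{P})$ is an algebra homomorphism and $\beta:\mathcal{P}\to\mathcal{U}(\mathcal{P})$ is a Lie algebra homomorphism with $[\beta(a),\alpha(b)]=\alpha(\{a,b\})$ and $\beta(ab)=\beta(a)\alpha(b)+\alpha(a)\beta(b)$ for all $a,b\in\mathcal{P}$: for every other such triple $(\mathcal{U}',\alpha',\beta')$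 there is a unique algebra homomorphism $f:\mathcal{U}(\mathcal{P})\to\mathcal{U}'$ with $\alpha'=f\alpha$, $\beta'=f\beta$. One writes $a=\alpha(a)$ and $\delta_a=\beta(a)$. For $a\in\mathcal{P}$ let $\mathrm{pad}_a=\{a,\cdot\}$. $P\mathcal{D}(\mathcal{P})$ is the subalgebra of $\mathrm{End}_K(\mathcal{P})$ generated by the multiplications by elements of $\mathcal{P}$ and all $\mathrm{pad}_a$, $a\in\mathcal{P}$. There is an algebra epimorphism $\pi_{\mathcal{P}}:\mathcal{U}(\mathcal{P})\to P\mathcal{D}(\mathcal{P})$, $a\mapsto a$, $\delta_b\mapsto\mathrm{pad}_b$; the left $\mathcal{U}(\mathcal{P})$-module structure on $\mathcal{P}$ is the one given by $\pi_{\mathcal{P}}$.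
   Formalization: The product rule for the enveloping algebra is taken as β(ab)=α(b)β(a)+α(a)β(b); the printed β(ab)=β(a)α(b)+α(a)β(b) would leave no epimorphism π unless the bracket is zero, and then the two rules agree. *)

theory Defs
  imports "HOL-Algebra.Algebra"
begin

section \<open>Associative algebras\<close>

text \<open>The library locale \<open>algebra\<close> is restricted to commutative algebras; this is its counterpart
  for associative unital algebras that need not be commutative.\<close>

locale assoc_algebra = module + ring M +
  assumes smult_mult_left:
    "\<lbrakk>k \<in> carrier R; x \<in> carrier M; y \<in> carrier M\<rbrakk> \<Longrightarrow>
      (k \<odot>\<^bsub>M\<^esub> x) \<otimes>\<^bsub>M\<^esub> y = k \<odot>\<^bsub>M\<^esub> (x \<otimes>\<^bsub>M\<^esub> y)"
    and smult_mult_right: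
    "\<lbrakk>k \<in> carrier R; x \<in> carrier M; y \<in> carrier M\<rbrakk> \<Longrightarrow>
      x \<otimes>\<^bsub>M\<^esub> (k \<odot>\<^bsub>M\<^esub> y) = k \<odot>\<^bsub>M\<^esub> (x \<otimes>\<^bsub>M\<^esub> y)"

lemma assoc_algebraI:
  assumes "cring K" "ring A"
    and "\<And>k x. \<lbrakk>k \<in> carrier K; x \<in> carrier A\<rbrakk> \<Longrightarrow> k \<odot>\<^bsub>A\<^esub> x \<in> carrier A"
    and "\<And>k l x. \<lbrakk>k \<in> carrier K; l \<in> carrier K; x \<in> carrier A\<rbrakk> \<Longrightarrow>
      (k \<oplus>\<^bsub>K\<^esub> l) \<odot>\<^bsub>A\<^esub> x = (k \<odot>\<^bsub>A\<^esub> x) \<oplus>\<^bsub>A\<^esub> (l \<odot>\<^bsub>A\<^esub> x)"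
    and "\<And>k x y. \<lbrakk>k \<in> carrier K; x \<in> carrier A; y \<in> carrier A\<rbrakk> \<Longrightarrow>
      k \<odot>\<^bsub>A\<^esub> (x \<oplus>\<^bsub>A\<^esub> y) = (k \<odot>\<^bsub>A\<^esub> x) \<oplus>\<^bsub>A\<^esub> (k \<odot>\<^bsub>A\<^esub> y)"
    and "\<And>k l x. \<lbrakk>k \<in> carrier K; l \<in> carrier K; x \<in> carrier A\<rbrakk> \<Longrightarrow>
      (k \<otimes>\<^bsub>K\<^esub> l) \<odot>\<^bsub>A\<^esub> x = k \<odot>\<^bsub>A\<^esub> (l \<odot>\<^bsub>A\<^esub> x)"
    and "\<And>x. x \<in> carrier A \<Longrightarrow> \<one>\<^bsub>K\<^esub> \<odot>\<^bsub>A\<^esub> x = x"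
    and "\<And>k x y. \<lbrakk>k \<in> carrier K; x \<in> carrier A; y \<in> carrier A\<rbrakk> \<Longrightarrow>
      (k \<odot>\<^bsub>A\<^esub> x) \<otimes>\<^bsub>A\<^esub> y = k \<odot>\<^bsub>A\<^esub> (x \<otimes>\<^bsub>A\<^esub> y)"
    and "\<And>k x y. \<lbrakk>k \<in> carrier K; x \<in> carrier A; y \<in> carrier A\<rbrakk> \<Longrightarrow>
      x \<otimes>\<^bsub>A\<^esub> (k \<odot>\<^bsub>A\<^esub> y) = k \<odot>\<^bsub>A\<^esub> (x \<otimes>\<^bsub>A\<^esub> y)"
  shows "assoc_algebra K A"
  by (intro assoc_algebra.intro assoc_algebra_axioms.intro moduleI assms
      ring.is_abelian_group[OF assms(2)])

definition algebra_hom ::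
  "('k, 'm) ring_scheme \<Rightarrow> ('k, 'a, 'x) module_scheme \<Rightarrow> ('k, 'b, 'y) module_scheme \<Rightarrow> ('a \<Rightarrow> 'b) set"
  where "algebra_hom K A B =
    {h \<in> ring_hom A B. \<forall>k\<in>carrier K. \<forall>x\<in>carrier A. h (k \<odot>\<^bsub>A\<^esub> x) = k \<odot>\<^bsub>B\<^esub> h x}"

definition isomorphic_algebras ::
  "('k, 'm) ring_scheme \<Rightarrow> ('k, 'a, 'x) module_scheme \<Rightarrow> ('k, 'b, 'y) module_scheme \<Rightarrow> bool"
  where "isomorphic_algebras K A B \<longleftrightarrow>
    (\<exists>h \<in> algebra_hom K A B. bij_betw h (carrier A) (carrier B))"

text \<open>Two-sided ring ideals of a unital algebra are automatically subspaces, so scalars play no role.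
  The zero algebra is not simple.\<close>

definition simple_algebra :: "('a, 'x) ring_scheme \<Rightarrow> bool"
  where "simple_algebra A \<longleftrightarrow>
    carrier A \<noteq> {\<zero>\<^bsub>A\<^esub>} \<and> (\<forall>I. ideal I A \<longrightarrow> I = {\<zero>\<^bsub>A\<^esub>} \<or> I = carrier A)"

definition subalgebra_of ::
  "('k, 'm) ring_scheme \<Rightarrow> ('k, 'a, 'x) module_scheme \<Rightarrow> 'a set \<Rightarrow> bool"
  where "subalgebra_of K A B \<longleftrightarrow>
    subring B A \<and> (\<forall>k\<in>carrier K. \<forall>x\<in>B. k \<odot>\<^bsub>A\<^esub> x \<in> B)"

definition generated_subalgebra ::
  "('k, 'm) ring_scheme \<Rightarrow> ('k, 'a, 'x) module_scheme \<Rightarrow> 'a set \<Rightarrow> 'a set"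
  where "generated_subalgebra K A S = \<Inter>{B. subalgebra_of K A B \<and> S \<subseteq> B}"

text \<open>The library's modules have commutative scalar rings, hence a separate notion of left module,
  with the action given as a function.\<close>

locale left_module = A?: ring A + M?: abelian_group M
  for A :: "('a, 'x) ring_scheme" (structure) and M :: "('b, 'y) ring_scheme" (structure)
    and act :: "'a \<Rightarrow> 'b \<Rightarrow> 'b" +
  assumes act_closed: "\<lbrakk>u \<in> carrier A; x \<in> carrier M\<rbrakk> \<Longrightarrow> act u x \<in> carrier M"
    and act_l_distr: "\<lbrakk>u \<in> carrier A; v \<in> carrier A; x \<in> carrier M\<rbrakk> \<Longrightarrow>
      act (u \<oplus>\<^bsub>A\<^esub> v) x = act u x \<oplus>\<^bsub>M\<^esub> act v x"
    and act_r_distr: "\<lbrakk>u \<in> carrier A; x \<in> carrier M; y \<in> carrier M\<rbrakk> \<Longrightarrow>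
      act u (x \<oplus>\<^bsub>M\<^esub> y) = act u x \<oplus>\<^bsub>M\<^esub> act u y"
    and act_assoc: "\<lbrakk>u \<in> carrier A; v \<in> carrier A; x \<in> carrier M\<rbrakk> \<Longrightarrow>
      act (u \<otimes>\<^bsub>A\<^esub> v) x = act u (act v x)"
    and act_one: "x \<in> carrier M \<Longrightarrow> act \<one>\<^bsub>A\<^esub> x = x"

locale faithful_left_module = left_module +
  assumes faithful:
    "\<lbrakk>u \<in> carrier A; \<And>x. x \<in> carrier M \<Longrightarrow> act u x = \<zero>\<^bsub>M\<^esub>\<rbrakk> \<Longrightarrow> u = \<zero>\<^bsub>A\<^esub>"

section \<open>Poisson algebras\<close>

record ('k, 'a) poisson = "('k, 'a) module" +
  pbracket :: "'a \<Rightarrow> 'a \<Rightarrow> 'a" (\<open>(\<lbrace>_,/ _\<rbrace>\<index>)\<close>)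

locale poisson_algebra = K?: field K + P?: algebra K P
  for K :: "('k, 'm) ring_scheme" (structure)
    and P :: "('k, 'p, 'n) poisson_scheme" (structure) +
  assumes bracket_closed: "\<lbrakk>a \<in> carrier P; b \<in> carrier P\<rbrakk> \<Longrightarrow> \<lbrace>a, b\<rbrace>\<^bsub>P\<^esub> \<in> carrier P"
    and bracket_add_left: "\<lbrakk>a \<in> carrier P; b \<in> carrier P; c \<in> carrier P\<rbrakk> \<Longrightarrow>
      \<lbrace>a \<oplus>\<^bsub>P\<^esub> b, c\<rbrace>\<^bsub>P\<^esub> = \<lbrace>a, c\<rbrace>\<^bsub>P\<^esub> \<oplus>\<^bsub>P\<^esub> \<lbrace>b, c\<rbrace>\<^bsub>P\<^esub>"
    and bracket_add_right: "\<lbrakk>a \<in> carrier P; b \<in> carrier P; c \<in> carrier P\<rbrakk> \<Longrightarrow>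
      \<lbrace>a, b \<oplus>\<^bsub>P\<^esub> c\<rbrace>\<^bsub>P\<^esub> = \<lbrace>a, b\<rbrace>\<^bsub>P\<^esub> \<oplus>\<^bsub>P\<^esub> \<lbrace>a, c\<rbrace>\<^bsub>P\<^esub>"
    and bracket_smult_left: "\<lbrakk>k \<in> carrier K; a \<in> carrier P; b \<in> carrier P\<rbrakk> \<Longrightarrow>
      \<lbrace>k \<odot>\<^bsub>P\<^esub> a, b\<rbrace>\<^bsub>P\<^esub> = k \<odot>\<^bsub>P\<^esub> \<lbrace>a, b\<rbrace>\<^bsub>P\<^esub>"
    and bracket_smult_right: "\<lbrakk>k \<in> carrier K; a \<in> carrier P; b \<in> carrier P\<rbrakk> \<Longrightarrow>
      \<lbrace>a, k \<odot>\<^bsub>P\<^esub> b\<rbrace>\<^bsub>P\<^esub> = k \<odot>\<^bsub>P\<^esub> \<lbrace>a, b\<rbrace>\<^bsub>P\<^esub>"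
    and bracket_self: "a \<in> carrier P \<Longrightarrow> \<lbrace>a, a\<rbrace>\<^bsub>P\<^esub> = \<zero>\<^bsub>P\<^esub>"
    and jacobi: "\<lbrakk>a \<in> carrier P; b \<in> carrier P; c \<in> carrier P\<rbrakk> \<Longrightarrow>
      \<lbrace>a, \<lbrace>b, c\<rbrace>\<^bsub>P\<^esub>\<rbrace>\<^bsub>P\<^esub> \<oplus>\<^bsub>P\<^esub> \<lbrace>b, \<lbrace>c, a\<rbrace>\<^bsub>P\<^esub>\<rbrace>\<^bsub>P\<^esub> \<oplus>\<^bsub>P\<^esub> \<lbrace>c, \<lbrace>a, b\<rbrace>\<^bsub>P\<^esub>\<rbrace>\<^bsub>P\<^esub> = \<zero>\<^bsub>P\<^esub>"
    and leibniz: "\<lbrakk>a \<in> carrier P; x \<in> carrier P; y \<in> carrier P\<rbrakk> \<Longrightarrow>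
      \<lbrace>a, x \<otimes>\<^bsub>P\<^esub> y\<rbrace>\<^bsub>P\<^esub> = \<lbrace>a, x\<rbrace>\<^bsub>P\<^esub> \<otimes>\<^bsub>P\<^esub> y \<oplus>\<^bsub>P\<^esub> x \<otimes>\<^bsub>P\<^esub> \<lbrace>a, y\<rbrace>\<^bsub>P\<^esub>"

definition poisson_ideal :: "'a set \<Rightarrow> ('k, 'a, 'x) poisson_scheme \<Rightarrow> bool"
  where "poisson_ideal J P \<longleftrightarrow>
    ideal J P \<and> (\<forall>a\<in>carrier P. \<forall>x\<in>J. \<lbrace>a, x\<rbrace>\<^bsub>P\<^esub> \<in> J)"

text \<open>As for algebras, the zero Poisson algebra is not simple.\<close>

definition poisson_simple :: "('k, 'a, 'x) poisson_scheme \<Rightarrow> bool"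
  where "poisson_simple P \<longleftrightarrow>
    carrier P \<noteq> {\<zero>\<^bsub>P\<^esub>} \<and> (\<forall>J. poisson_ideal J P \<longrightarrow> J = {\<zero>\<^bsub>P\<^esub>} \<or> J = carrier P)"

section \<open>The algebra of Poisson differential operators\<close>

text \<open>Linear maps are normalised to be \<open>undefined\<close> outside the carrier, so that equality of
  elements is equality of maps on the carrier.\<close>

definition end_algebra ::
  "('k, 'm) ring_scheme \<Rightarrow> ('k, 'a, 'x) module_scheme \<Rightarrow> ('k, 'a \<Rightarrow> 'a) module"
  where "end_algebra K V =
    \<lparr>carrier = {f \<in> carrier V \<rightarrow>\<^sub>E carrier V.
        (\<forall>x\<in>carrier V. \<forall>y\<in>carrier V. f (x \<oplus>\<^bsub>V\<^esub> y) = f x \<oplus>\<^bsub>V\<^esub> f y) \<and>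
        (\<forall>k\<in>carrier K. \<forall>x\<in>carrier V. f (k \<odot>\<^bsub>V\<^esub> x) = k \<odot>\<^bsub>V\<^esub> f x)},
     monoid.mult = compose (carrier V),
     monoid.one = (\<lambda>x\<in>carrier V. x),
     ring.zero = (\<lambda>x\<in>carrier V. \<zero>\<^bsub>V\<^esub>),
     ring.add = (\<lambda>f g. \<lambda>x\<in>carrier V. f x \<oplus>\<^bsub>V\<^esub> g x),
     module.smult = (\<lambda>k f. \<lambda>x\<in>carrier V. k \<odot>\<^bsub>V\<^esub> f x)\<rparr>"

definition pmul :: "('k, 'a, 'x) poisson_scheme \<Rightarrow> 'a \<Rightarrow> 'a \<Rightarrow> 'a"
  where "pmul P a = (\<lambda>x\<in>carrier P. a \<otimes>\<^bsub>P\<^esub> x)"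

definition pad :: "('k, 'a, 'x) poisson_scheme \<Rightarrow> 'a \<Rightarrow> 'a \<Rightarrow> 'a"
  where "pad P a = (\<lambda>x\<in>carrier P. \<lbrace>a, x\<rbrace>\<^bsub>P\<^esub>)"

definition PD ::
  "('k, 'm) ring_scheme \<Rightarrow> ('k, 'a, 'x) poisson_scheme \<Rightarrow> ('k, 'a \<Rightarrow> 'a) module"
  where "PD K P = end_algebra K P
    \<lparr>carrier := generated_subalgebra K (end_algebra K P) (pmul P ` carrier P \<union> pad P ` carrier P)\<rparr>"

section \<open>The Poisson enveloping algebra\<close>

text \<open>The product rule for \<open>\<beta>\<close> is \<open>\<beta>(ab) = \<alpha>(b)\<beta>(a) + \<alpha>(a)\<beta>(b)\<close>, with the image of \<open>\<alpha>\<close> on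
  the left in both summands. The variant \<open>\<beta>(ab) = \<beta>(a)\<alpha>(b) + \<alpha>(a)\<beta>(b)\<close> differs from it by
  \<open>\<alpha>({a,b})\<close>: together with the commutator rule it would force \<open>2\<alpha>({a,b}) = 0\<close>, and
  multiplications and \<open>pad\<close> do not satisfy it unless the bracket is zero, so that there would be
  no homomorphism \<open>penv_pi\<close>.\<close>

locale poisson_triple = poisson_algebra K P + B?: assoc_algebra K B
  for K :: "('k, 'm) ring_scheme" (structure)
    and P :: "('k, 'p, 'n) poisson_scheme" (structure)
    and B :: "('k, 'b, 'x) module_scheme" (structure)
    and \<alpha> :: "'p \<Rightarrow> 'b" and \<beta> :: "'p \<Rightarrow> 'b" +
  assumes alpha_hom: "\<alpha> \<in> algebra_hom K P B"
    and beta_closed: "a \<in> carrier P \<Longrightarrow> \<beta> a \<in> carrier B"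
    and beta_add: "\<lbrakk>a \<in> carrier P; b \<in> carrier P\<rbrakk> \<Longrightarrow> \<beta> (a \<oplus>\<^bsub>P\<^esub> b) = \<beta> a \<oplus>\<^bsub>B\<^esub> \<beta> b"
    and beta_smult: "\<lbrakk>k \<in> carrier K; a \<in> carrier P\<rbrakk> \<Longrightarrow> \<beta> (k \<odot>\<^bsub>P\<^esub> a) = k \<odot>\<^bsub>B\<^esub> \<beta> a"
    and beta_bracket: "\<lbrakk>a \<in> carrier P; b \<in> carrier P\<rbrakk> \<Longrightarrow>
      \<beta> (\<lbrace>a, b\<rbrace>\<^bsub>P\<^esub>) = \<beta> a \<otimes>\<^bsub>B\<^esub> \<beta> b \<ominus>\<^bsub>B\<^esub> \<beta> b \<otimes>\<^bsub>B\<^esub> \<beta> a"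
    and beta_alpha_comm: "\<lbrakk>a \<in> carrier P; b \<in> carrier P\<rbrakk> \<Longrightarrow>
      \<beta> a \<otimes>\<^bsub>B\<^esub> \<alpha> b \<ominus>\<^bsub>B\<^esub> \<alpha> b \<otimes>\<^bsub>B\<^esub> \<beta> a = \<alpha> (\<lbrace>a, b\<rbrace>\<^bsub>P\<^esub>)"
    and beta_mult: "\<lbrakk>a \<in> carrier P; b \<in> carrier P\<rbrakk> \<Longrightarrow>
      \<beta> (a \<otimes>\<^bsub>P\<^esub> b) = \<alpha> b \<otimes>\<^bsub>B\<^esub> \<beta> a \<oplus>\<^bsub>B\<^esub> \<alpha> a \<otimes>\<^bsub>B\<^esub> \<beta> b"

text \<open>A universal property quantifies over algebras on all types, which is not possible inside a
  HOL definition. The universal triple is therefore constructed, by generators and relations: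
  formal algebra expressions in symbols \<open>Alpha a\<close> and \<open>Beta a\<close>, modulo the least congruence
  containing the axioms of associative algebras and the defining relations of a Poisson triple.
  Theorems \<open>penv_triple\<close> and \<open>penv_universal\<close> below establish that it is a triple, and
  that it is universal among the triples on an arbitrary type.\<close>

datatype ('k, 'a) penv_term =
    Alpha 'a
  | Beta 'a
  | TZero
  | TOne
  | TAdd "('k, 'a) penv_term" "('k, 'a) penv_term"
  | TMult "('k, 'a) penv_term" "('k, 'a) penv_term"
  | TSmult 'k "('k, 'a) penv_term"

inductive_set penv_terms ::
  "('k, 'm) ring_scheme \<Rightarrow> ('k, 'a, 'x) poisson_scheme \<Rightarrow> ('k, 'a) penv_term set"
  for K :: "('k, 'm) ring_scheme" and P :: "('k, 'a, 'x) poisson_scheme"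
  where
    "a \<in> carrier P \<Longrightarrow> Alpha a \<in> penv_terms K P"
  | "a \<in> carrier P \<Longrightarrow> Beta a \<in> penv_terms K P"
  | "TZero \<in> penv_terms K P"
  | "TOne \<in> penv_terms K P"
  | "\<lbrakk>s \<in> penv_terms K P; t \<in> penv_terms K P\<rbrakk> \<Longrightarrow> TAdd s t \<in> penv_terms K P"
  | "\<lbrakk>s \<in> penv_terms K P; t \<in> penv_terms K P\<rbrakk> \<Longrightarrow> TMult s t \<in> penv_terms K P"
  | "\<lbrakk>k \<in> carrier K; t \<in> penv_terms K P\<rbrakk> \<Longrightarrow> TSmult k t \<in> penv_terms K P"

definition TComm ::
  "('k, 'm) ring_scheme \<Rightarrow> ('k, 'a) penv_term \<Rightarrow> ('k, 'a) penv_term \<Rightarrow> ('k, 'a) penv_term"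
  where "TComm K s t = TAdd (TMult s t) (TSmult (\<ominus>\<^bsub>K\<^esub> \<one>\<^bsub>K\<^esub>) (TMult t s))"

inductive penv_eq ::
  "('k, 'm) ring_scheme \<Rightarrow> ('k, 'a, 'x) poisson_scheme \<Rightarrow>
    ('k, 'a) penv_term \<Rightarrow> ('k, 'a) penv_term \<Rightarrow> bool"
  for K :: "('k, 'm) ring_scheme" and P :: "('k, 'a, 'x) poisson_scheme"
  where
    refl: "t \<in> penv_terms K P \<Longrightarrow> penv_eq K P t t"
  | sym: "penv_eq K P s t \<Longrightarrow> penv_eq K P t s"
  | trans: "\<lbrakk>penv_eq K P s t; penv_eq K P t u\<rbrakk> \<Longrightarrow> penv_eq K P s u"
  | add_cong: "\<lbrakk>penv_eq K P s s'; penv_eq K P t t'\<rbrakk> \<Longrightarrow> penv_eq K P (TAdd s t) (TAdd s' t')"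
  | mult_cong: "\<lbrakk>penv_eq K P s s'; penv_eq K P t t'\<rbrakk> \<Longrightarrow> penv_eq K P (TMult s t) (TMult s' t')"
  | smult_cong: "\<lbrakk>k \<in> carrier K; penv_eq K P t t'\<rbrakk> \<Longrightarrow> penv_eq K P (TSmult k t) (TSmult k t')"
  | add_assoc: "\<lbrakk>s \<in> penv_terms K P; t \<in> penv_terms K P; u \<in> penv_terms K P\<rbrakk> \<Longrightarrow>
      penv_eq K P (TAdd (TAdd s t) u) (TAdd s (TAdd t u))"
  | add_comm: "\<lbrakk>s \<in> penv_terms K P; t \<in> penv_terms K P\<rbrakk> \<Longrightarrow> penv_eq K P (TAdd s t) (TAdd t s)"
  | add_zero: "t \<in> penv_terms K P \<Longrightarrow> penv_eq K P (TAdd TZero t) t"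
  | add_neg: "t \<in> penv_terms K P \<Longrightarrow>
      penv_eq K P (TAdd (TSmult (\<ominus>\<^bsub>K\<^esub> \<one>\<^bsub>K\<^esub>) t) t) TZero"
  | mult_assoc: "\<lbrakk>s \<in> penv_terms K P; t \<in> penv_terms K P; u \<in> penv_terms K P\<rbrakk> \<Longrightarrow>
      penv_eq K P (TMult (TMult s t) u) (TMult s (TMult t u))"
  | one_mult: "t \<in> penv_terms K P \<Longrightarrow> penv_eq K P (TMult TOne t) t"
  | mult_one: "t \<in> penv_terms K P \<Longrightarrow> penv_eq K P (TMult t TOne) t"
  | distrib_left: "\<lbrakk>s \<in> penv_terms K P; t \<in> penv_terms K P; u \<in> penv_terms K P\<rbrakk> \<Longrightarrow>
      penv_eq K P (TMult (TAdd s t) u) (TAdd (TMult s u) (TMult t u))"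
  | distrib_right: "\<lbrakk>s \<in> penv_terms K P; t \<in> penv_terms K P; u \<in> penv_terms K P\<rbrakk> \<Longrightarrow>
      penv_eq K P (TMult u (TAdd s t)) (TAdd (TMult u s) (TMult u t))"
  | smult_add_left: "\<lbrakk>k \<in> carrier K; l \<in> carrier K; t \<in> penv_terms K P\<rbrakk> \<Longrightarrow>
      penv_eq K P (TSmult (k \<oplus>\<^bsub>K\<^esub> l) t) (TAdd (TSmult k t) (TSmult l t))"
  | smult_add_right: "\<lbrakk>k \<in> carrier K; s \<in> penv_terms K P; t \<in> penv_terms K P\<rbrakk> \<Longrightarrow>
      penv_eq K P (TSmult k (TAdd s t)) (TAdd (TSmult k s) (TSmult k t))"
  | smult_assoc: "\<lbrakk>k \<in> carrier K; l \<in> carrier K; t \<in> penv_terms K P\<rbrakk> \<Longrightarrow>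
      penv_eq K P (TSmult (k \<otimes>\<^bsub>K\<^esub> l) t) (TSmult k (TSmult l t))"
  | smult_one: "t \<in> penv_terms K P \<Longrightarrow> penv_eq K P (TSmult \<one>\<^bsub>K\<^esub> t) t"
  | smult_mult_left: "\<lbrakk>k \<in> carrier K; s \<in> penv_terms K P; t \<in> penv_terms K P\<rbrakk> \<Longrightarrow>
      penv_eq K P (TMult (TSmult k s) t) (TSmult k (TMult s t))"
  | smult_mult_right: "\<lbrakk>k \<in> carrier K; s \<in> penv_terms K P; t \<in> penv_terms K P\<rbrakk> \<Longrightarrow>
      penv_eq K P (TMult s (TSmult k t)) (TSmult k (TMult s t))"
  | Alpha_one: "penv_eq K P (Alpha \<one>\<^bsub>P\<^esub>) TOne"
  | Alpha_add: "\<lbrakk>a \<in> carrier P; b \<in> carrier P\<rbrakk> \<Longrightarrow>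
      penv_eq K P (Alpha (a \<oplus>\<^bsub>P\<^esub> b)) (TAdd (Alpha a) (Alpha b))"
  | Alpha_mult: "\<lbrakk>a \<in> carrier P; b \<in> carrier P\<rbrakk> \<Longrightarrow>
      penv_eq K P (Alpha (a \<otimes>\<^bsub>P\<^esub> b)) (TMult (Alpha a) (Alpha b))"
  | Alpha_smult: "\<lbrakk>k \<in> carrier K; a \<in> carrier P\<rbrakk> \<Longrightarrow>
      penv_eq K P (Alpha (k \<odot>\<^bsub>P\<^esub> a)) (TSmult k (Alpha a))"
  | Beta_add: "\<lbrakk>a \<in> carrier P; b \<in> carrier P\<rbrakk> \<Longrightarrow>
      penv_eq K P (Beta (a \<oplus>\<^bsub>P\<^esub> b)) (TAdd (Beta a) (Beta b))"
  | Beta_smult: "\<lbrakk>k \<in> carrier K; a \<in> carrier P\<rbrakk> \<Longrightarrow>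
      penv_eq K P (Beta (k \<odot>\<^bsub>P\<^esub> a)) (TSmult k (Beta a))"
  | Beta_bracket: "\<lbrakk>a \<in> carrier P; b \<in> carrier P\<rbrakk> \<Longrightarrow>
      penv_eq K P (Beta (\<lbrace>a, b\<rbrace>\<^bsub>P\<^esub>)) (TComm K (Beta a) (Beta b))"
  | Beta_Alpha_comm: "\<lbrakk>a \<in> carrier P; b \<in> carrier P\<rbrakk> \<Longrightarrow>
      penv_eq K P (TComm K (Beta a) (Alpha b)) (Alpha (\<lbrace>a, b\<rbrace>\<^bsub>P\<^esub>))"
  | Beta_mult: "\<lbrakk>a \<in> carrier P; b \<in> carrier P\<rbrakk> \<Longrightarrow>
      penv_eq K P (Beta (a \<otimes>\<^bsub>P\<^esub> b)) (TAdd (TMult (Alpha b) (Beta a)) (TMult (Alpha a) (Beta b)))"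

definition penv_class ::
  "('k, 'm) ring_scheme \<Rightarrow> ('k, 'a, 'x) poisson_scheme \<Rightarrow>
    ('k, 'a) penv_term \<Rightarrow> ('k, 'a) penv_term set"
  where "penv_class K P t = {s. penv_eq K P t s}"

definition penv ::
  "('k, 'm) ring_scheme \<Rightarrow> ('k, 'a, 'x) poisson_scheme \<Rightarrow> ('k, ('k, 'a) penv_term set) module"
  where "penv K P =
    \<lparr>carrier = penv_class K P ` penv_terms K P,
     monoid.mult = (\<lambda>S T. \<Union>s\<in>S. \<Union>t\<in>T. penv_class K P (TMult s t)),
     monoid.one = penv_class K P TOne,
     ring.zero = penv_class K P TZero,
     ring.add = (\<lambda>S T. \<Union>s\<in>S. \<Union>t\<in>T. penv_class K P (TAdd s t)),
     module.smult = (\<lambda>k T. \<Union>t\<in>T. penv_class K P (TSmult k t))\<rparr>"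

definition penv_alpha ::
  "('k, 'm) ring_scheme \<Rightarrow> ('k, 'a, 'x) poisson_scheme \<Rightarrow> 'a \<Rightarrow> ('k, 'a) penv_term set"
  where "penv_alpha K P a = penv_class K P (Alpha a)"

definition penv_beta ::
  "('k, 'm) ring_scheme \<Rightarrow> ('k, 'a, 'x) poisson_scheme \<Rightarrow> 'a \<Rightarrow> ('k, 'a) penv_term set"
  where "penv_beta K P a = penv_class K P (Beta a)"

text \<open>The epimorphism onto the Poisson differential operators (existence, uniqueness and surjectivity
  are shown below in \<open>penv_pi_ex1\<close> and \<open>penv_pi_surj\<close>), and the resulting action.\<close>

definition penv_pi ::
  "('k, 'm) ring_scheme \<Rightarrow> ('k, 'a, 'x) poisson_scheme \<Rightarrow> ('k, 'a) penv_term set \<Rightarrow> 'a \<Rightarrow> 'a"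
  where "penv_pi K P = (THE f. f \<in> algebra_hom K (penv K P) (PD K P) \<and>
    f \<in> extensional (carrier (penv K P)) \<and>
    (\<forall>a\<in>carrier P. f (penv_alpha K P a) = pmul P a \<and> f (penv_beta K P a) = pad P a))"

definition penv_action ::
  "('k, 'm) ring_scheme \<Rightarrow> ('k, 'a, 'x) poisson_scheme \<Rightarrow> ('k, 'a) penv_term set \<Rightarrow> 'a \<Rightarrow> 'a"
  where "penv_action K P u x = penv_pi K P u x"

subsection \<open>The construction is a triple\<close>

context poisson_algebra
begin

lemma penv_eq_terms:
  "penv_eq K P s t \<Longrightarrow> s \<in> penv_terms K P \<and> t \<in> penv_terms K P"
  by (induction rule: penv_eq.induct)
    (auto simp: TComm_def bracket_closed intro!: penv_terms.intros)

lemma penv_class_eq: "penv_eq K P s t \<Longrightarrow> penv_class K P s = penv_class K P t"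
  unfolding penv_class_def by (blast intro: penv_eq.sym penv_eq.trans)

lemma penv_class_self: "t \<in> penv_terms K P \<Longrightarrow> t \<in> penv_class K P t"
  unfolding penv_class_def by (simp add: penv_eq.refl)

lemma penv_class_D:
  "penv_class K P s = penv_class K P t \<Longrightarrow> t \<in> penv_terms K P \<Longrightarrow> penv_eq K P s t"
  using penv_class_self[of t] unfolding penv_class_def by blast

lemma penv_mult_class:
  assumes "s \<in> penv_terms K P" "t \<in> penv_terms K P"
  shows "penv_class K P s \<otimes>\<^bsub>penv K P\<^esub> penv_class K P t = penv_class K P (TMult s t)"
proof -
  have "penv_class K P (TMult x y) = penv_class K P (TMult s t)"
    if "x \<in> penv_class K P s" "y \<in> penv_class K P t" for x y
    using that penv_class_eq[OF penv_eq.mult_cong, of s x t y] by (simp add: penv_class_def[of K P s] penv_class_def[of K P t])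
  then have "(\<Union>x\<in>penv_class K P s. \<Union>y\<in>penv_class K P t. penv_class K P (TMult x y)) =
      (\<Union>x\<in>penv_class K P s. \<Union>y\<in>penv_class K P t. penv_class K P (TMult s t))"
    by simp
  also have "\<dots> = penv_class K P (TMult s t)"
    using assms[THEN penv_class_self] by (simp add: UN_constant) blast
  finally show ?thesis by (simp add: penv_def)
qed

lemma penv_add_class:
  assumes "s \<in> penv_terms K P" "t \<in> penv_terms K P"
  shows "penv_class K P s \<oplus>\<^bsub>penv K P\<^esub> penv_class K P t = penv_class K P (TAdd s t)"
proof -
  have "penv_class K P (TAdd x y) = penv_class K P (TAdd s t)"
    if "x \<in> penv_class K P s" "y \<in> penv_class K P t" for x y
    using that penv_class_eq[OF penv_eq.add_cong, of s x t y] by (simp add: penv_class_def[of K P s] penv_class_def[of K P t])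
  then have "(\<Union>x\<in>penv_class K P s. \<Union>y\<in>penv_class K P t. penv_class K P (TAdd x y)) =
      (\<Union>x\<in>penv_class K P s. \<Union>y\<in>penv_class K P t. penv_class K P (TAdd s t))"
    by simp
  also have "\<dots> = penv_class K P (TAdd s t)"
    using assms[THEN penv_class_self] by (simp add: UN_constant) blast
  finally show ?thesis by (simp add: penv_def)
qed

lemma penv_smult_class:
  assumes "k \<in> carrier K" "t \<in> penv_terms K P"
  shows "k \<odot>\<^bsub>penv K P\<^esub> penv_class K P t = penv_class K P (TSmult k t)"
proof -
  have "penv_class K P (TSmult k x) = penv_class K P (TSmult k t)" if "x \<in> penv_class K P t" for x
    using that penv_class_eq[OF penv_eq.smult_cong[OF assms(1)], of t x]
    by (simp add: penv_class_def[of K P t])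
  then have "(\<Union>x\<in>penv_class K P t. penv_class K P (TSmult k x)) =
      (\<Union>x\<in>penv_class K P t. penv_class K P (TSmult k t))"
    by simp
  also have "\<dots> = penv_class K P (TSmult k t)"
    using penv_class_self[OF assms(2)] by (simp add: UN_constant) blast
  finally show ?thesis by (simp add: penv_def)
qed

lemma penv_one_class: "\<one>\<^bsub>penv K P\<^esub> = penv_class K P TOne"
  and penv_zero_class: "\<zero>\<^bsub>penv K P\<^esub> = penv_class K P TZero"
  and penv_carrier: "carrier (penv K P) = penv_class K P ` penv_terms K P"
  by (simp_all add: penv_def)

lemmas penv_class_simps =
  penv_mult_class penv_add_class penv_smult_class penv_one_class penv_zero_class penv_carrier
  penv_terms.intros

lemma penv_closed:
  assumes "x \<in> carrier (penv K P)"
  obtains t where "t \<in> penv_terms K P" "x = penv_class K P t"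
  using assms unfolding penv_carrier by blast

lemma penv_assoc_algebra: "assoc_algebra K (penv K P)"
proof -
  note [simp] = penv_terms.intros
  note class_simps = penv_mult_class penv_add_class penv_smult_class
  have ab: "abelian_group (penv K P)"
  proof (rule abelian_groupI, goal_cases)
    case (3 x y z)
    then show ?case
      by (auto simp only: penv_carrier class_simps penv_terms.intros
          penv_eq.add_assoc[THEN penv_class_eq])
  next
    case (4 x y)
    then show ?case
      by (auto simp only: penv_carrier class_simps intro!: penv_eq.add_comm[THEN penv_class_eq] del: equalityI)
  next
    case (6 x)
    then obtain t where t: "t \<in> penv_terms K P" "x = penv_class K P t"
      by (auto simp: penv_carrier)
    have "penv_class K P (TSmult (\<ominus>\<^bsub>K\<^esub> \<one>\<^bsub>K\<^esub>) t) \<oplus>\<^bsub>penv K P\<^esub> x = \<zero>\<^bsub>penv K P\<^esub>"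
      using t by (simp add: class_simps penv_zero_class penv_class_eq[OF penv_eq.add_neg])
    then show ?case
      using t by (auto simp: penv_carrier)
  qed (auto simp: penv_carrier class_simps penv_zero_class penv_class_eq[OF penv_eq.add_zero])
  have mon: "monoid (penv K P)"
    by (rule monoidI)
      (auto simp: penv_carrier class_simps penv_one_class penv_class_eq[OF penv_eq.one_mult]
        penv_class_eq[OF penv_eq.mult_one] penv_class_eq[OF penv_eq.mult_assoc])
  have "ring (penv K P)"
    by (rule ringI[OF ab mon])
      (auto simp: penv_carrier class_simps penv_class_eq[OF penv_eq.distrib_left]
        penv_class_eq[OF penv_eq.distrib_right])
  then show ?thesis
  proof (rule assoc_algebraI[OF K.is_cring])
    fix k x assume k: "k \<in> carrier K" and x: "x \<in> carrier (penv K P)"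
    obtain s where s: "s \<in> penv_terms K P" "x = penv_class K P s"
      using x by (rule penv_closed)
    show "k \<odot>\<^bsub>penv K P\<^esub> x \<in> carrier (penv K P)"
      using k s by (simp add: class_simps penv_carrier)
    fix l assume l: "l \<in> carrier K"
    show "(k \<oplus>\<^bsub>K\<^esub> l) \<odot>\<^bsub>penv K P\<^esub> x = k \<odot>\<^bsub>penv K P\<^esub> x \<oplus>\<^bsub>penv K P\<^esub> l \<odot>\<^bsub>penv K P\<^esub> x"
      using k l s by (simp add: class_simps penv_class_eq[OF penv_eq.smult_add_left])
    show "(k \<otimes>\<^bsub>K\<^esub> l) \<odot>\<^bsub>penv K P\<^esub> x = k \<odot>\<^bsub>penv K P\<^esub> (l \<odot>\<^bsub>penv K P\<^esub> x)"
      using k l s by (simp add: class_simps penv_class_eq[OF penv_eq.smult_assoc])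
  next
    fix x assume "x \<in> carrier (penv K P)"
    then obtain s where s: "s \<in> penv_terms K P" "x = penv_class K P s"
      by (rule penv_closed)
    show "\<one>\<^bsub>K\<^esub> \<odot>\<^bsub>penv K P\<^esub> x = x"
      using s by (simp add: class_simps penv_class_eq[OF penv_eq.smult_one])
  next
    fix k x y
    assume k: "k \<in> carrier K" and x: "x \<in> carrier (penv K P)" and y: "y \<in> carrier (penv K P)"
    obtain s where s: "s \<in> penv_terms K P" "x = penv_class K P s"
      using x by (rule penv_closed)
    obtain t where t: "t \<in> penv_terms K P" "y = penv_class K P t"
      using y by (rule penv_closed)
    show "k \<odot>\<^bsub>penv K P\<^esub> (x \<oplus>\<^bsub>penv K P\<^esub> y) = k \<odot>\<^bsub>penv K P\<^esub> x \<oplus>\<^bsub>penv K P\<^esub> k \<odot>\<^bsub>penv K P\<^esub> y"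
      using k s t by (simp add: class_simps penv_class_eq[OF penv_eq.smult_add_right])
    show "(k \<odot>\<^bsub>penv K P\<^esub> x) \<otimes>\<^bsub>penv K P\<^esub> y = k \<odot>\<^bsub>penv K P\<^esub> (x \<otimes>\<^bsub>penv K P\<^esub> y)"
      using k s t by (simp add: class_simps penv_class_eq[OF penv_eq.smult_mult_left])
    show "x \<otimes>\<^bsub>penv K P\<^esub> (k \<odot>\<^bsub>penv K P\<^esub> y) = k \<odot>\<^bsub>penv K P\<^esub> (x \<otimes>\<^bsub>penv K P\<^esub> y)"
      using k s t by (simp add: class_simps penv_class_eq[OF penv_eq.smult_mult_right])
  qed
qed

lemma penv_comm_class:
  assumes "s \<in> penv_terms K P" "t \<in> penv_terms K P"
  shows "penv_class K P s \<otimes>\<^bsub>penv K P\<^esub> penv_class K P t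
      \<ominus>\<^bsub>penv K P\<^esub> penv_class K P t \<otimes>\<^bsub>penv K P\<^esub> penv_class K P s =
    penv_class K P (TComm K s t)"
proof -
  interpret U: assoc_algebra K "penv K P" by (rule penv_assoc_algebra)
  have st: "penv_class K P (TMult t s) \<in> carrier (penv K P)"
    using assms by (auto simp: penv_carrier intro!: penv_terms.intros)
  have "\<ominus>\<^bsub>penv K P\<^esub> penv_class K P (TMult t s) =
      (\<ominus>\<^bsub>K\<^esub> \<one>\<^bsub>K\<^esub>) \<odot>\<^bsub>penv K P\<^esub> penv_class K P (TMult t s)"
    using U.smult_l_minus[OF K.one_closed st] U.smult_one[OF st] by simp
  then show ?thesis
    unfolding a_minus_def TComm_def penv_mult_class[OF assms] penv_mult_class[OF assms(2,1)]
    using assms by (simp add: penv_smult_class penv_add_class penv_terms.intros)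
qed

theorem penv_triple: "poisson_triple K P (penv K P) (penv_alpha K P) (penv_beta K P)"
proof (intro poisson_triple.intro poisson_triple_axioms.intro penv_assoc_algebra)
  note [simp] = penv_terms.intros bracket_closed
  note class_simps = penv_mult_class penv_add_class penv_smult_class
  show "poisson_algebra K P" by (rule poisson_algebra_axioms)
  have "penv_alpha K P \<in> ring_hom P (penv K P)"
  proof (rule ring_hom_memI)
    show "penv_alpha K P \<one>\<^bsub>P\<^esub> = \<one>\<^bsub>penv K P\<^esub>"
      unfolding penv_alpha_def penv_one_class by (rule penv_class_eq, rule penv_eq.Alpha_one)
  qed (simp_all add: penv_alpha_def penv_carrier class_simps
      penv_class_eq[OF penv_eq.Alpha_mult] penv_class_eq[OF penv_eq.Alpha_add])
  moreover have "penv_alpha K P (k \<odot>\<^bsub>P\<^esub> a) = k \<odot>\<^bsub>penv K P\<^esub> penv_alpha K P a"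
    if "k \<in> carrier K" "a \<in> carrier P" for k a
    using that by (simp add: penv_alpha_def class_simps penv_class_eq[OF penv_eq.Alpha_smult])
  ultimately show "penv_alpha K P \<in> algebra_hom K P (penv K P)"
    by (simp add: algebra_hom_def)
  fix a assume a: "a \<in> carrier P"
  show "penv_beta K P a \<in> carrier (penv K P)"
    using a by (simp add: penv_beta_def penv_carrier)
  show "penv_beta K P (k \<odot>\<^bsub>P\<^esub> a) = k \<odot>\<^bsub>penv K P\<^esub> penv_beta K P a" if "k \<in> carrier K" for k
    using that a by (simp add: penv_beta_def class_simps penv_class_eq[OF penv_eq.Beta_smult])
  fix b assume b: "b \<in> carrier P"
  show "penv_beta K P (a \<oplus>\<^bsub>P\<^esub> b) = penv_beta K P a \<oplus>\<^bsub>penv K P\<^esub> penv_beta K P b"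
    using a b by (simp add: penv_beta_def class_simps penv_class_eq[OF penv_eq.Beta_add])
  show "penv_beta K P (\<lbrace>a, b\<rbrace>\<^bsub>P\<^esub>) = penv_beta K P a \<otimes>\<^bsub>penv K P\<^esub> penv_beta K P b
      \<ominus>\<^bsub>penv K P\<^esub> penv_beta K P b \<otimes>\<^bsub>penv K P\<^esub> penv_beta K P a"
    using a b by (simp add: penv_beta_def penv_comm_class penv_class_eq[OF penv_eq.Beta_bracket])
  show "penv_beta K P a \<otimes>\<^bsub>penv K P\<^esub> penv_alpha K P b
      \<ominus>\<^bsub>penv K P\<^esub> penv_alpha K P b \<otimes>\<^bsub>penv K P\<^esub> penv_beta K P a = penv_alpha K P (\<lbrace>a, b\<rbrace>\<^bsub>P\<^esub>)"
    using a b
    by (simp add: penv_alpha_def penv_beta_def penv_comm_class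
        penv_class_eq[OF penv_eq.Beta_Alpha_comm])
  show "penv_beta K P (a \<otimes>\<^bsub>P\<^esub> b) = penv_alpha K P b \<otimes>\<^bsub>penv K P\<^esub> penv_beta K P a
      \<oplus>\<^bsub>penv K P\<^esub> penv_alpha K P a \<otimes>\<^bsub>penv K P\<^esub> penv_beta K P b"
    using a b
    by (simp add: penv_alpha_def penv_beta_def class_simps penv_class_eq[OF penv_eq.Beta_mult])
qed

end

subsection \<open>The construction is universal\<close>

primrec penv_eval ::
  "('k, 'b, 'y) module_scheme \<Rightarrow> ('a \<Rightarrow> 'b) \<Rightarrow> ('a \<Rightarrow> 'b) \<Rightarrow> ('k, 'a) penv_term \<Rightarrow> 'b"
  where
    "penv_eval B \<alpha> \<beta> (Alpha a) = \<alpha> a"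
  | "penv_eval B \<alpha> \<beta> (Beta a) = \<beta> a"
  | "penv_eval B \<alpha> \<beta> TZero = \<zero>\<^bsub>B\<^esub>"
  | "penv_eval B \<alpha> \<beta> TOne = \<one>\<^bsub>B\<^esub>"
  | "penv_eval B \<alpha> \<beta> (TAdd s t) = penv_eval B \<alpha> \<beta> s \<oplus>\<^bsub>B\<^esub> penv_eval B \<alpha> \<beta> t"
  | "penv_eval B \<alpha> \<beta> (TMult s t) = penv_eval B \<alpha> \<beta> s \<otimes>\<^bsub>B\<^esub> penv_eval B \<alpha> \<beta> t"
  | "penv_eval B \<alpha> \<beta> (TSmult k t) = k \<odot>\<^bsub>B\<^esub> penv_eval B \<alpha> \<beta> t"

lemma algebra_homD:
  assumes "h \<in> algebra_hom K A B"
  shows "x \<in> carrier A \<Longrightarrow> h x \<in> carrier B"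
    and "\<lbrakk>x \<in> carrier A; y \<in> carrier A\<rbrakk> \<Longrightarrow> h (x \<oplus>\<^bsub>A\<^esub> y) = h x \<oplus>\<^bsub>B\<^esub> h y"
    and "\<lbrakk>x \<in> carrier A; y \<in> carrier A\<rbrakk> \<Longrightarrow> h (x \<otimes>\<^bsub>A\<^esub> y) = h x \<otimes>\<^bsub>B\<^esub> h y"
    and "h \<one>\<^bsub>A\<^esub> = \<one>\<^bsub>B\<^esub>"
    and "\<lbrakk>k \<in> carrier K; x \<in> carrier A\<rbrakk> \<Longrightarrow> h (k \<odot>\<^bsub>A\<^esub> x) = k \<odot>\<^bsub>B\<^esub> h x"
  using assms unfolding algebra_hom_def ring_hom_def by auto

context poisson_triple
begin

lemma penv_eval_closed: "t \<in> penv_terms K P \<Longrightarrow> penv_eval B \<alpha> \<beta> t \<in> carrier B"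
  by (induction rule: penv_terms.induct) (auto simp: algebra_homD[OF alpha_hom] beta_closed)

lemma penv_eval_comm:
  assumes "s \<in> penv_terms K P" "t \<in> penv_terms K P"
  shows "penv_eval B \<alpha> \<beta> (TComm K s t) =
    penv_eval B \<alpha> \<beta> s \<otimes>\<^bsub>B\<^esub> penv_eval B \<alpha> \<beta> t \<ominus>\<^bsub>B\<^esub>
    penv_eval B \<alpha> \<beta> t \<otimes>\<^bsub>B\<^esub> penv_eval B \<alpha> \<beta> s"
proof -
  have "(\<ominus>\<^bsub>K\<^esub> \<one>\<^bsub>K\<^esub>) \<odot>\<^bsub>B\<^esub> (penv_eval B \<alpha> \<beta> t \<otimes>\<^bsub>B\<^esub> penv_eval B \<alpha> \<beta> s) =
      \<ominus>\<^bsub>B\<^esub> (penv_eval B \<alpha> \<beta> t \<otimes>\<^bsub>B\<^esub> penv_eval B \<alpha> \<beta> s)"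
    using assms[THEN penv_eval_closed] by (simp add: B.smult_l_minus)
  then show ?thesis by (simp add: TComm_def a_minus_def)
qed

lemma penv_eval_eq: "penv_eq K P s t \<Longrightarrow> penv_eval B \<alpha> \<beta> s = penv_eval B \<alpha> \<beta> t"
proof (induction rule: penv_eq.induct)
  case (add_neg t)
  then show ?case
    using penv_eval_closed[of t] by (simp add: B.smult_l_minus B.M.l_neg)
qed (simp_all add: penv_eval_closed penv_eval_comm penv_terms.intros algebra_homD[OF alpha_hom]
    B.smult_l_distr B.smult_r_distr B.smult_assoc1 B.smult_mult_left B.smult_mult_right
    B.l_distr B.r_distr B.M.a_ac B.m_assoc
    beta_closed beta_add beta_smult beta_bracket beta_alpha_comm beta_mult)

theorem penv_universal:
  "\<exists>!f. f \<in> algebra_hom K (penv K P) B \<and> f \<in> extensional (carrier (penv K P)) \<and>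
    (\<forall>a\<in>carrier P. f (penv_alpha K P a) = \<alpha> a \<and> f (penv_beta K P a) = \<beta> a)"
proof (rule ex_ex1I)
  define f where "f = (\<lambda>x\<in>carrier (penv K P). penv_eval B \<alpha> \<beta> (SOME t. t \<in> x))"
  have f: "f (penv_class K P t) = penv_eval B \<alpha> \<beta> t" if t: "t \<in> penv_terms K P" for t
  proof -
    have "(SOME s. s \<in> penv_class K P t) \<in> penv_class K P t"
      by (rule someI, rule penv_class_self, rule t)
    then have "penv_eval B \<alpha> \<beta> (SOME s. s \<in> penv_class K P t) = penv_eval B \<alpha> \<beta> t"
      unfolding penv_class_def using penv_eval_eq by (metis mem_Collect_eq)
    then show ?thesis
      using t by (simp add: f_def penv_carrier)
  qed
  have "f \<in> algebra_hom K (penv K P) B"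
    by (auto simp: algebra_hom_def ring_hom_def penv_class_simps f penv_eval_closed)
  moreover have "f \<in> extensional (carrier (penv K P))"
    by (simp add: f_def)
  moreover have "\<forall>a\<in>carrier P. f (penv_alpha K P a) = \<alpha> a \<and> f (penv_beta K P a) = \<beta> a"
    by (simp add: penv_alpha_def penv_beta_def f penv_terms.intros)
  ultimately show "\<exists>f. f \<in> algebra_hom K (penv K P) B \<and> f \<in> extensional (carrier (penv K P)) \<and>
    (\<forall>a\<in>carrier P. f (penv_alpha K P a) = \<alpha> a \<and> f (penv_beta K P a) = \<beta> a)"
    by blast
next
  interpret U: assoc_algebra K "penv K P" by (rule penv_assoc_algebra)
  fix f g
  assume f: "f \<in> algebra_hom K (penv K P) B \<and> f \<in> extensional (carrier (penv K P)) \<and>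
      (\<forall>a\<in>carrier P. f (penv_alpha K P a) = \<alpha> a \<and> f (penv_beta K P a) = \<beta> a)"
    and g: "g \<in> algebra_hom K (penv K P) B \<and> g \<in> extensional (carrier (penv K P)) \<and>
      (\<forall>a\<in>carrier P. g (penv_alpha K P a) = \<alpha> a \<and> g (penv_beta K P a) = \<beta> a)"
  have *: "h (penv_class K P t) = penv_eval B \<alpha> \<beta> t"
    if t: "t \<in> penv_terms K P" and h: "h \<in> algebra_hom K (penv K P) B"
      "\<forall>a\<in>carrier P. h (penv_alpha K P a) = \<alpha> a \<and> h (penv_beta K P a) = \<beta> a" for h t
    using t
  proof (induction rule: penv_terms.induct)
    case 3
    have "h \<zero>\<^bsub>penv K P\<^esub> \<oplus>\<^bsub>B\<^esub> h \<zero>\<^bsub>penv K P\<^esub> = h \<zero>\<^bsub>penv K P\<^esub>"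
      using algebra_homD(2)[OF h(1), of "\<zero>\<^bsub>penv K P\<^esub>" "\<zero>\<^bsub>penv K P\<^esub>"] by simp
    then show ?case
      using algebra_homD(1)[OF h(1) U.zero_closed] by (simp add: penv_zero_class)
  next
    case (5 s t)
    then show ?case
      using algebra_homD(2)[OF h(1), of "penv_class K P s" "penv_class K P t"]
      by (simp add: penv_class_simps)
  next
    case (6 s t)
    then show ?case
      using algebra_homD(3)[OF h(1), of "penv_class K P s" "penv_class K P t"]
      by (simp add: penv_class_simps)
  next
    case (7 k t)
    then show ?case
      using algebra_homD(5)[OF h(1), of k "penv_class K P t"]
      by (simp add: penv_class_simps)
  qed (use h algebra_homD(4)[OF h(1)] in
      \<open>simp_all add: penv_alpha_def penv_beta_def penv_one_class\<close>)
  show "f = g"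
  proof (rule extensionalityI)
    fix x assume "x \<in> carrier (penv K P)"
    then obtain t where t: "t \<in> penv_terms K P" "x = penv_class K P t"
      by (rule penv_closed)
    show "f x = g x"
      using *[OF t(1), of f] *[OF t(1), of g] f g t(2) by simp
  qed (use f g in auto)
qed

end

subsection \<open>The epimorphism onto the Poisson differential operators\<close>

context poisson_algebra
begin

lemma smult_left_commute:
  assumes "k \<in> carrier K" "l \<in> carrier K" "x \<in> carrier P"
  shows "k \<odot>\<^bsub>P\<^esub> (l \<odot>\<^bsub>P\<^esub> x) = l \<odot>\<^bsub>P\<^esub> (k \<odot>\<^bsub>P\<^esub> x)"
  using P.smult_assoc1[of k l x] P.smult_assoc1[of l k x] K.m_comm[of k l] assms by simp

lemma end_assoc_algebra: "assoc_algebra K (end_algebra K P)"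
proof (rule assoc_algebraI)
  have ab: "abelian_group (end_algebra K P)"
  proof (rule abelian_groupI, goal_cases)
    case (6 f)
    then show ?case
      by (intro bexI[of _ "\<lambda>x\<in>carrier P. \<ominus>\<^bsub>P\<^esub> f x"])
        (auto simp: end_algebra_def PiE_iff P.M.l_neg P.M.minus_add P.smult_r_minus
          P.M.add.inv_mult_group extensional_def intro!: ext)
  qed (auto simp: end_algebra_def PiE_iff P.M.a_ac P.smult_r_distr extensional_def intro!: ext)
  have mon: "monoid (end_algebra K P)"
    by (rule monoidI)
      (auto simp: end_algebra_def PiE_iff compose_def extensional_def intro!: ext)
  show "ring (end_algebra K P)"
    by (rule ringI[OF ab mon])
      (auto simp: end_algebra_def PiE_iff compose_def extensional_def intro!: ext)
  show "cring K" by (rule K.is_cring)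
qed (auto simp: end_algebra_def PiE_iff compose_def extensional_def P.smult_r_distr
    P.smult_l_distr P.smult_assoc1 smult_left_commute intro!: ext)

lemma subalgebra_of_assoc_algebra:
  assumes "assoc_algebra K A" "subalgebra_of K A S"
  shows "assoc_algebra K (A\<lparr>carrier := S\<rparr>)"
proof -
  interpret A: assoc_algebra K A by (rule assms(1))
  have S: "subring S A" and "\<And>k x. k \<in> carrier K \<Longrightarrow> x \<in> S \<Longrightarrow> k \<odot>\<^bsub>A\<^esub> x \<in> S"
    using assms(2) by (auto simp: subalgebra_of_def)
  moreover have "x \<in> carrier A" if "x \<in> S" for x
    using subringE(1)[OF S] that by blast
  ultimately show ?thesis
    by (intro assoc_algebraI K.is_cring A.subring_is_ring)
      (auto simp: A.smult_l_distr A.smult_r_distr A.smult_assoc1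
        A.smult_mult_left A.smult_mult_right)
qed

lemma generated_subalgebra_of:
  assumes "assoc_algebra K A" "S \<subseteq> carrier A"
  shows "subalgebra_of K A (generated_subalgebra K A S)"
proof -
  interpret A: assoc_algebra K A by (rule assms(1))
  let ?F = "{B. subalgebra_of K A B \<and> S \<subseteq> B}"
  have top: "carrier A \<in> ?F"
    using assms(2) A.carrier_is_subring by (auto simp: subalgebra_of_def)
  have "subring (\<Inter>?F) A"
  proof (rule A.subringI)
    show "\<Inter>?F \<subseteq> carrier A" using top by blast
  qed (auto simp: subalgebra_of_def dest: subringE(3,5-7))
  then show ?thesis
    by (auto simp: generated_subalgebra_def subalgebra_of_def)
qed

lemma bracket_skew:
  assumes "a \<in> carrier P" "b \<in> carrier P"
  shows "\<lbrace>a, b\<rbrace>\<^bsub>P\<^esub> = \<ominus>\<^bsub>P\<^esub> \<lbrace>b, a\<rbrace>\<^bsub>P\<^esub>"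
proof -
  have "\<lbrace>a, b\<rbrace>\<^bsub>P\<^esub> \<oplus>\<^bsub>P\<^esub> \<lbrace>b, a\<rbrace>\<^bsub>P\<^esub> = \<lbrace>a \<oplus>\<^bsub>P\<^esub> b, a\<rbrace>\<^bsub>P\<^esub> \<oplus>\<^bsub>P\<^esub> \<lbrace>a \<oplus>\<^bsub>P\<^esub> b, b\<rbrace>\<^bsub>P\<^esub>"
    using assms by (simp add: bracket_add_left bracket_closed bracket_self P.M.a_comm)
  also have "\<dots> = \<zero>\<^bsub>P\<^esub>"
    using assms bracket_self[of "a \<oplus>\<^bsub>P\<^esub> b"] bracket_add_right[of "a \<oplus>\<^bsub>P\<^esub> b" a b] by simp
  finally have "\<lbrace>a, b\<rbrace>\<^bsub>P\<^esub> \<oplus>\<^bsub>P\<^esub> \<lbrace>b, a\<rbrace>\<^bsub>P\<^esub> = \<zero>\<^bsub>P\<^esub>" .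
  then show ?thesis
    using assms by (simp add: P.M.minus_equality bracket_closed)
qed

lemma bracket_bracket:
  assumes "a \<in> carrier P" "b \<in> carrier P" "x \<in> carrier P"
  shows "\<lbrace>a, \<lbrace>b, x\<rbrace>\<^bsub>P\<^esub>\<rbrace>\<^bsub>P\<^esub> = \<lbrace>\<lbrace>a, b\<rbrace>\<^bsub>P\<^esub>, x\<rbrace>\<^bsub>P\<^esub> \<oplus>\<^bsub>P\<^esub> \<lbrace>b, \<lbrace>a, x\<rbrace>\<^bsub>P\<^esub>\<rbrace>\<^bsub>P\<^esub>"
proof -
  have c: "\<lbrace>a, \<lbrace>b, x\<rbrace>\<^bsub>P\<^esub>\<rbrace>\<^bsub>P\<^esub> \<in> carrier P" "\<lbrace>b, \<lbrace>x, a\<rbrace>\<^bsub>P\<^esub>\<rbrace>\<^bsub>P\<^esub> \<in> carrier P"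
    "\<lbrace>x, \<lbrace>a, b\<rbrace>\<^bsub>P\<^esub>\<rbrace>\<^bsub>P\<^esub> \<in> carrier P" "\<lbrace>b, \<lbrace>a, x\<rbrace>\<^bsub>P\<^esub>\<rbrace>\<^bsub>P\<^esub> \<in> carrier P"
    using assms by (simp_all add: bracket_closed)
  have 1: "\<lbrace>\<lbrace>a, b\<rbrace>\<^bsub>P\<^esub>, x\<rbrace>\<^bsub>P\<^esub> = \<ominus>\<^bsub>P\<^esub> \<lbrace>x, \<lbrace>a, b\<rbrace>\<^bsub>P\<^esub>\<rbrace>\<^bsub>P\<^esub>"
    using assms by (intro bracket_skew) (simp_all add: bracket_closed)
  have "\<lbrace>b, \<lbrace>x, a\<rbrace>\<^bsub>P\<^esub>\<rbrace>\<^bsub>P\<^esub> \<oplus>\<^bsub>P\<^esub> \<lbrace>b, \<lbrace>a, x\<rbrace>\<^bsub>P\<^esub>\<rbrace>\<^bsub>P\<^esub> = \<lbrace>b, \<zero>\<^bsub>P\<^esub>\<rbrace>\<^bsub>P\<^esub>"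
    using assms bracket_skew[of x a]
    by (simp flip: bracket_add_right add: bracket_closed P.M.l_neg)
  moreover have "\<lbrace>b, \<zero>\<^bsub>P\<^esub>\<rbrace>\<^bsub>P\<^esub> = \<zero>\<^bsub>P\<^esub>"
    using bracket_smult_right[of "\<zero>\<^bsub>K\<^esub>" b "\<zero>\<^bsub>P\<^esub>"] assms by (simp add: bracket_closed)
  ultimately have 2: "\<lbrace>b, \<lbrace>a, x\<rbrace>\<^bsub>P\<^esub>\<rbrace>\<^bsub>P\<^esub> = \<ominus>\<^bsub>P\<^esub> \<lbrace>b, \<lbrace>x, a\<rbrace>\<^bsub>P\<^esub>\<rbrace>\<^bsub>P\<^esub>"
    using c by (metis P.M.a_comm P.M.minus_equality)
  have "\<lbrace>a, \<lbrace>b, x\<rbrace>\<^bsub>P\<^esub>\<rbrace>\<^bsub>P\<^esub> \<oplus>\<^bsub>P\<^esub> (\<lbrace>b, \<lbrace>x, a\<rbrace>\<^bsub>P\<^esub>\<rbrace>\<^bsub>P\<^esub> \<oplus>\<^bsub>P\<^esub> \<lbrace>x, \<lbrace>a, b\<rbrace>\<^bsub>P\<^esub>\<rbrace>\<^bsub>P\<^esub>) = \<zero>\<^bsub>P\<^esub>"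
    using jacobi[OF assms] c by (simp add: P.M.a_assoc)
  then have "\<lbrace>a, \<lbrace>b, x\<rbrace>\<^bsub>P\<^esub>\<rbrace>\<^bsub>P\<^esub> = \<ominus>\<^bsub>P\<^esub> (\<lbrace>b, \<lbrace>x, a\<rbrace>\<^bsub>P\<^esub>\<rbrace>\<^bsub>P\<^esub> \<oplus>\<^bsub>P\<^esub> \<lbrace>x, \<lbrace>a, b\<rbrace>\<^bsub>P\<^esub>\<rbrace>\<^bsub>P\<^esub>)"
    using c by (metis P.M.minus_equality P.M.a_closed)
  then show ?thesis
    unfolding 1 2 using c by (simp add: P.M.minus_add P.M.a_comm)
qed

lemma bracket_mult_left:
  assumes "a \<in> carrier P" "b \<in> carrier P" "x \<in> carrier P"
  shows "\<lbrace>a \<otimes>\<^bsub>P\<^esub> b, x\<rbrace>\<^bsub>P\<^esub> = b \<otimes>\<^bsub>P\<^esub> \<lbrace>a, x\<rbrace>\<^bsub>P\<^esub> \<oplus>\<^bsub>P\<^esub> a \<otimes>\<^bsub>P\<^esub> \<lbrace>b, x\<rbrace>\<^bsub>P\<^esub>"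
proof -
  have "\<lbrace>a \<otimes>\<^bsub>P\<^esub> b, x\<rbrace>\<^bsub>P\<^esub> = \<ominus>\<^bsub>P\<^esub> (\<lbrace>x, a\<rbrace>\<^bsub>P\<^esub> \<otimes>\<^bsub>P\<^esub> b \<oplus>\<^bsub>P\<^esub> a \<otimes>\<^bsub>P\<^esub> \<lbrace>x, b\<rbrace>\<^bsub>P\<^esub>)"
    using assms bracket_skew[of "a \<otimes>\<^bsub>P\<^esub> b" x] leibniz[of x a b] by simp
  also have "\<dots> = b \<otimes>\<^bsub>P\<^esub> (\<ominus>\<^bsub>P\<^esub> \<lbrace>x, a\<rbrace>\<^bsub>P\<^esub>) \<oplus>\<^bsub>P\<^esub> a \<otimes>\<^bsub>P\<^esub> (\<ominus>\<^bsub>P\<^esub> \<lbrace>x, b\<rbrace>\<^bsub>P\<^esub>)"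
    using assms by (simp add: bracket_closed P.M.minus_add P.m_comm P.r_minus)
  finally show ?thesis
    using assms bracket_skew[of a x] bracket_skew[of b x] by simp
qed

lemma pmul_end: "a \<in> carrier P \<Longrightarrow> pmul P a \<in> carrier (end_algebra K P)"
  by (auto simp: end_algebra_def pmul_def P.r_distr P.m_comm[of a] P.smult_assoc2)

lemma pad_end: "a \<in> carrier P \<Longrightarrow> pad P a \<in> carrier (end_algebra K P)"
  by (auto simp: end_algebra_def pad_def bracket_closed bracket_add_right bracket_smult_right)

lemma PD_subalgebra: "subalgebra_of K (end_algebra K P) (carrier (PD K P))"
proof -
  have "pmul P ` carrier P \<union> pad P ` carrier P \<subseteq> carrier (end_algebra K P)"
    using pmul_end pad_end by blast
  from generated_subalgebra_of[OF end_assoc_algebra this] show ?thesis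
    by (simp add: PD_def)
qed

lemma PD_eq: "PD K P = end_algebra K P\<lparr>carrier := carrier (PD K P)\<rparr>"
  by (simp add: PD_def)

lemma PD_assoc_algebra: "assoc_algebra K (PD K P)"
  using subalgebra_of_assoc_algebra[OF end_assoc_algebra PD_subalgebra] PD_eq by simp

lemma pmul_PD: "a \<in> carrier P \<Longrightarrow> pmul P a \<in> carrier (PD K P)"
  and pad_PD: "a \<in> carrier P \<Longrightarrow> pad P a \<in> carrier (PD K P)"
  by (auto simp: PD_def generated_subalgebra_def)

lemma PD_ops:
  "f \<otimes>\<^bsub>PD K P\<^esub> g = compose (carrier P) f g"
  "f \<oplus>\<^bsub>PD K P\<^esub> g = (\<lambda>x\<in>carrier P. f x \<oplus>\<^bsub>P\<^esub> g x)"
  "k \<odot>\<^bsub>PD K P\<^esub> f = (\<lambda>x\<in>carrier P. k \<odot>\<^bsub>P\<^esub> f x)"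
  "\<one>\<^bsub>PD K P\<^esub> = (\<lambda>x\<in>carrier P. x)"
  "\<zero>\<^bsub>PD K P\<^esub> = (\<lambda>x\<in>carrier P. \<zero>\<^bsub>P\<^esub>)"
  by (simp_all add: PD_def end_algebra_def)

lemma PD_triple: "poisson_triple K P (PD K P) (pmul P) (pad P)"
proof -
  interpret D: assoc_algebra K "PD K P" by (rule PD_assoc_algebra)
  have minus: "f \<ominus>\<^bsub>PD K P\<^esub> g = h"
    if "f = h \<oplus>\<^bsub>PD K P\<^esub> g" "g \<in> carrier (PD K P)" "h \<in> carrier (PD K P)" for f g h
    using that by (simp add: a_minus_def D.M.a_assoc D.M.r_neg)
  show ?thesis
  proof (intro poisson_triple.intro poisson_triple_axioms.intro PD_assoc_algebra
      poisson_algebra_axioms)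
    show "pmul P \<in> algebra_hom K P (PD K P)"
      using pmul_PD by (auto simp: algebra_hom_def ring_hom_def)
        (auto simp: PD_ops pmul_def compose_def P.l_distr P.m_assoc P.smult_assoc2 intro!: ext)
    fix a b assume ab: "a \<in> carrier P" "b \<in> carrier P"
    show "pad P (\<lbrace>a, b\<rbrace>\<^bsub>P\<^esub>) = pad P a \<otimes>\<^bsub>PD K P\<^esub> pad P b \<ominus>\<^bsub>PD K P\<^esub> pad P b \<otimes>\<^bsub>PD K P\<^esub> pad P a"
    proof (rule minus[symmetric])
      show "pad P a \<otimes>\<^bsub>PD K P\<^esub> pad P b =
          pad P (\<lbrace>a, b\<rbrace>\<^bsub>P\<^esub>) \<oplus>\<^bsub>PD K P\<^esub> pad P b \<otimes>\<^bsub>PD K P\<^esub> pad P a"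
        using ab by (auto simp: PD_ops pad_def compose_def bracket_closed bracket_bracket[of a b]
            intro!: ext)
    qed (use ab in \<open>simp_all add: pad_PD bracket_closed\<close>)
    show "pad P a \<otimes>\<^bsub>PD K P\<^esub> pmul P b \<ominus>\<^bsub>PD K P\<^esub> pmul P b \<otimes>\<^bsub>PD K P\<^esub> pad P a = pmul P (\<lbrace>a, b\<rbrace>\<^bsub>P\<^esub>)"
    proof (rule minus)
      show "pad P a \<otimes>\<^bsub>PD K P\<^esub> pmul P b =
          pmul P (\<lbrace>a, b\<rbrace>\<^bsub>P\<^esub>) \<oplus>\<^bsub>PD K P\<^esub> pmul P b \<otimes>\<^bsub>PD K P\<^esub> pad P a"
        using ab by (auto simp: PD_ops pad_def pmul_def compose_def bracket_closed leibniz
            intro!: ext)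
    qed (use ab in \<open>simp_all add: pad_PD pmul_PD bracket_closed\<close>)
    show "pad P (a \<otimes>\<^bsub>P\<^esub> b) = pmul P b \<otimes>\<^bsub>PD K P\<^esub> pad P a \<oplus>\<^bsub>PD K P\<^esub> pmul P a \<otimes>\<^bsub>PD K P\<^esub> pad P b"
      using ab by (auto simp: PD_ops pad_def pmul_def compose_def bracket_closed
          bracket_mult_left intro!: ext)
    show "pad P (a \<oplus>\<^bsub>P\<^esub> b) = pad P a \<oplus>\<^bsub>PD K P\<^esub> pad P b"
      using ab by (auto simp: PD_ops pad_def bracket_add_left intro!: ext)
  next
    show "pad P a \<in> carrier (PD K P)" if "a \<in> carrier P" for a
      using that by (rule pad_PD)
    fix k a assume "k \<in> carrier K" "a \<in> carrier P"
    then show "pad P (k \<odot>\<^bsub>P\<^esub> a) = k \<odot>\<^bsub>PD K P\<^esub> pad P a"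
      by (auto simp: PD_ops pad_def bracket_smult_left intro!: ext)
  qed
qed

lemma penv_pi_ex1:
  "\<exists>!f. f \<in> algebra_hom K (penv K P) (PD K P) \<and> f \<in> extensional (carrier (penv K P)) \<and>
    (\<forall>a\<in>carrier P. f (penv_alpha K P a) = pmul P a \<and> f (penv_beta K P a) = pad P a)"
  by (rule poisson_triple.penv_universal[OF PD_triple])

lemma penv_pi_hom: "penv_pi K P \<in> algebra_hom K (penv K P) (PD K P)"
  and penv_pi_alpha: "a \<in> carrier P \<Longrightarrow> penv_pi K P (penv_alpha K P a) = pmul P a"
  and penv_pi_beta: "a \<in> carrier P \<Longrightarrow> penv_pi K P (penv_beta K P a) = pad P a"
  using theI'[OF penv_pi_ex1] unfolding penv_pi_def by auto

lemma penv_pi_surj: "penv_pi K P ` carrier (penv K P) = carrier (PD K P)"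
proof
  interpret U: assoc_algebra K "penv K P" by (rule penv_assoc_algebra)
  interpret D: assoc_algebra K "PD K P" by (rule PD_assoc_algebra)
  interpret T: poisson_triple K P "penv K P" "penv_alpha K P" "penv_beta K P" by (rule penv_triple)
  show "penv_pi K P ` carrier (penv K P) \<subseteq> carrier (PD K P)"
    using algebra_homD(1)[OF penv_pi_hom] by blast
  interpret h: ring_hom_ring "penv K P" "PD K P" "penv_pi K P"
    using penv_pi_hom
    by (intro ring_hom_ringI2 U.ring_axioms D.ring_axioms) (simp add: algebra_hom_def)
  let ?I = "penv_pi K P ` carrier (penv K P)"
  interpret E: assoc_algebra K "end_algebra K P" by (rule end_assoc_algebra)
  have sub: "subring ?I (PD K P)"
    using h.img_is_subring[OF U.carrier_is_subring] .
  have "subring ?I (end_algebra K P)"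
  proof (rule E.subringI)
    show "?I \<subseteq> carrier (end_algebra K P)"
      using subringE(1)[OF sub] PD_subalgebra subringE(1) by (auto simp: subalgebra_of_def)
    fix f assume f: "f \<in> ?I"
    then have "f \<in> carrier (PD K P)" using subringE(1)[OF sub] by blast
    then have "f \<in> carrier (end_algebra K P)"
      using PD_subalgebra subringE(1) by (auto simp: subalgebra_of_def)
    then have "\<ominus>\<^bsub>end_algebra K P\<^esub> f = (\<ominus>\<^bsub>K\<^esub> \<one>\<^bsub>K\<^esub>) \<odot>\<^bsub>end_algebra K P\<^esub> f"
      by (simp add: E.smult_l_minus)
    also have "\<dots> = (\<ominus>\<^bsub>K\<^esub> \<one>\<^bsub>K\<^esub>) \<odot>\<^bsub>PD K P\<^esub> f"
      by (simp add: PD_def)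
    also have "\<dots> \<in> ?I"
      using f by (auto simp flip: algebra_homD(5)[OF penv_pi_hom])
    finally show "\<ominus>\<^bsub>end_algebra K P\<^esub> f \<in> ?I" .
  qed (use subringE(3,6,7)[OF sub] in \<open>auto simp: PD_def\<close>)
  moreover have "k \<odot>\<^bsub>end_algebra K P\<^esub> f \<in> ?I" if "k \<in> carrier K" "f \<in> ?I" for k f
  proof -
    have "k \<odot>\<^bsub>PD K P\<^esub> f \<in> ?I"
      using that by (auto simp flip: algebra_homD(5)[OF penv_pi_hom])
    then show ?thesis by (simp add: PD_def)
  qed
  ultimately have "subalgebra_of K (end_algebra K P) ?I"
    by (simp add: subalgebra_of_def)
  moreover have "pmul P ` carrier P \<union> pad P ` carrier P \<subseteq> ?I"
    using penv_pi_alpha penv_pi_beta algebra_homD(1)[OF T.alpha_hom] T.beta_closed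
    by (auto simp flip: penv_pi_alpha penv_pi_beta)
  ultimately show "carrier (PD K P) \<subseteq> ?I"
    by (auto simp: PD_def generated_subalgebra_def)
qed

lemma penv_left_module: "left_module (penv K P) P (penv_action K P)"
proof -
  interpret U: assoc_algebra K "penv K P" by (rule penv_assoc_algebra)
  have E: "penv_pi K P u \<in> carrier (end_algebra K P)" if "u \<in> carrier (penv K P)" for u
    using algebra_homD(1)[OF penv_pi_hom that] PD_subalgebra subringE(1)
    by (auto simp: subalgebra_of_def)
  show ?thesis
  proof (intro left_module.intro left_module_axioms.intro U.ring_axioms P.M.abelian_group_axioms)
    fix u x y assume u: "u \<in> carrier (penv K P)" and xy: "x \<in> carrier P" "y \<in> carrier P"
    show "penv_action K P u (x \<oplus>\<^bsub>P\<^esub> y) = penv_action K P u x \<oplus>\<^bsub>P\<^esub> penv_action K P u y"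
      using E[OF u] xy by (simp add: penv_action_def end_algebra_def)
  next
    fix u x assume "u \<in> carrier (penv K P)" "x \<in> carrier P"
    then show "penv_action K P u x \<in> carrier P"
      using E[of u] by (auto simp: penv_action_def end_algebra_def)
  qed (simp_all add: penv_action_def algebra_homD[OF penv_pi_hom] PD_ops compose_def)
qed

end

end

theory Submission
  imports Defs
begin

text \<open>A simple enveloping algebra \<open>U\<close> embeds into \<open>PD\<close> because the kernel of \<open>\<pi>\<close> is a proper ideal,
  and a proper Poisson ideal \<open>J\<close> of \<open>P\<close> is contained in the annihilator of \<open>P / J\<close>, a proper ideal
  of \<open>U\<close>. Conversely, commutators with elements of \<open>P\<close> lower the order of the elements of \<open>U\<close>, so
  every nonzero ideal \<open>I\<close> of \<open>U\<close> contains some \<open>u \<noteq> 0\<close> that commutes with all of \<open>P\<close>. Such an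
  element acts on \<open>P\<close> as multiplication by \<open>u \<cdot> 1\<close>, hence by faithfulness lies in \<open>P\<close>. As
  \<open>P \<inter> I\<close> is a Poisson ideal, \<open>1 \<in> I\<close>.\<close>

section \<open>Simple algebras and homomorphisms\<close>

text \<open>The kernel omits 1, because a ring with 1 = 0 is zero; simplicity then leaves only the
  zero kernel.\<close>

lemma (in ring_hom_ring) simple_algebra_imp_inj:
  assumes "simple_algebra R" "carrier S \<noteq> {\<zero>\<^bsub>S\<^esub>}"
  shows "inj_on h (carrier R)"
proof -
  have "a_kernel R S h \<noteq> carrier R"
  proof
    assume "a_kernel R S h = carrier R"
    then have "\<one>\<^bsub>S\<^esub> = \<zero>\<^bsub>S\<^esub>"
      using R.one_closed hom_one unfolding a_kernel_def' by force
    then show False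
      using assms(2) S.one_zeroD by blast
  qed
  then show ?thesis
    using assms(1) kernel_is_ideal unfolding simple_algebra_def
    by (intro trivial_ker_imp_inj) blast
qed

lemma simple_algebra_ring_iso:
  assumes "ring R" "ring S" "h \<in> ring_iso R S" "simple_algebra R"
  shows "simple_algebra S"
proof -
  interpret h: ring_hom_ring R S h
    using assms by (intro ring_hom_ringI2) (simp_all add: ring_iso_def)
  have bij: "bij_betw h (carrier R) (carrier S)"
    using assms(3) by (simp add: ring_iso_def)
  have zero: "h ` {\<zero>\<^bsub>R\<^esub>} = {\<zero>\<^bsub>S\<^esub>}" and all: "h ` carrier R = carrier S"
    using bij by (simp_all add: bij_betw_def)
  have "carrier S \<noteq> {\<zero>\<^bsub>S\<^esub>}"
    using assms(4) bij zero all inj_on_image_eq_iff[of h "carrier R" "carrier R" "{\<zero>\<^bsub>R\<^esub>}"]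
    by (auto simp: simple_algebra_def bij_betw_def)
  moreover have "I = {\<zero>\<^bsub>S\<^esub>} \<or> I = carrier S" if "ideal I S" for I
  proof -
    have "I \<subseteq> carrier S"
      using that by (meson additive_subgroup.a_subset ideal.axioms(1))
    \<comment> \<open>Surjectivity of \<open>h\<close> recovers \<open>I\<close> from its preimage,
      which is an ideal of the simple ring \<open>R\<close>.\<close>
    then have I: "I = h ` {r \<in> carrier R. h r \<in> I}"
      unfolding all[symmetric] by blast
    have "{r \<in> carrier R. h r \<in> I} = {\<zero>\<^bsub>R\<^esub>} \<or> {r \<in> carrier R. h r \<in> I} = carrier R"
      using h.ideal_vimage[OF that] assms(4) unfolding simple_algebra_def by blast
    then show ?thesis
      using I zero all by (elim disjE) simp_all
  qed
  ultimately show ?thesis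
    by (simp add: simple_algebra_def)
qed

section \<open>Commutators\<close>

text \<open>The elements of finite order with respect to commutators with \<open>S\<close>, in the manner of
  Grothendieck's differential operators. The induction may be transfinite, which does no harm.\<close>

inductive_set comm_nilpotent :: "('a, 'x) ring_scheme \<Rightarrow> 'a set \<Rightarrow> 'a set"
  for A :: "('a, 'x) ring_scheme" (structure) and S :: "'a set"
  where
    zero: "\<zero> \<in> comm_nilpotent A S"
  | comm: "\<lbrakk>f \<in> carrier A; \<And>s. s \<in> S \<Longrightarrow> f \<otimes> s \<ominus> s \<otimes> f \<in> comm_nilpotent A S\<rbrakk> \<Longrightarrow>
      f \<in> comm_nilpotent A S"

context ring
begin

lemma comm_nilpotent_closed: "f \<in> comm_nilpotent R S \<Longrightarrow> f \<in> carrier R"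
  by (induction rule: comm_nilpotent.induct) auto

text \<open>Inverts the rule \<open>comm\<close>; for the element introduced by \<open>zero\<close>,
  all commutators vanish. This serves the second summand in \<open>comm_nilpotent_add\<close>, which
  carries no induction hypothesis.\<close>

lemma comm_nilpotent_commutator:
  assumes "f \<in> comm_nilpotent R S" "s \<in> S" "S \<subseteq> carrier R"
  shows "f \<otimes> s \<ominus> s \<otimes> f \<in> comm_nilpotent R S"
  using assms(1)
proof cases
  case zero
  then show ?thesis
    using assms(2,3) by (auto simp: a_minus_def comm_nilpotent.zero subset_iff)
qed (use assms in auto)

lemma comm_nilpotent_add:
  assumes "f \<in> comm_nilpotent R S" "g \<in> comm_nilpotent R S" "S \<subseteq> carrier R"
  shows "f \<oplus> g \<in> comm_nilpotent R S"
  using assms(1,2)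
proof (induction arbitrary: g rule: comm_nilpotent.induct)
  case zero
  then show ?case by (simp add: comm_nilpotent_closed)
next
  case (comm f)
  have c: "f \<in> carrier R" "g \<in> carrier R"
    using comm by (auto intro: comm_nilpotent_closed)
  show ?case
  proof (rule comm_nilpotent.comm)
    fix s assume s: "s \<in> S"
    then have sc: "s \<in> carrier R" using assms(3) by blast
    have "(f \<oplus> g) \<otimes> s \<ominus> s \<otimes> (f \<oplus> g) = (f \<otimes> s \<ominus> s \<otimes> f) \<oplus> (g \<otimes> s \<ominus> s \<otimes> g)"
      using c sc by (simp add: a_minus_def l_distr r_distr minus_add a_ac)
    then show "(f \<oplus> g) \<otimes> s \<ominus> s \<otimes> (f \<oplus> g) \<in> comm_nilpotent R S"
      using comm.IH[OF s] comm_nilpotent_commutator[OF comm.prems s assms(3)] by simp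
  qed (use c in simp)
qed

text \<open>Commutation with \<open>s\<close> is a derivation: [fg, s] = f[g, s] + [f, s]g. The
  induction is nested: the inner one, on \<open>g\<close> with \<open>f\<close> fixed, treats the
  first summand; the outer one, on \<open>f\<close> with \<open>g\<close> arbitrary, treats the
  second.\<close>

lemma comm_nilpotent_mult:
  assumes "f \<in> comm_nilpotent R S" "g \<in> comm_nilpotent R S" "S \<subseteq> carrier R"
  shows "f \<otimes> g \<in> comm_nilpotent R S"
  using assms(1,2)
proof (induction arbitrary: g rule: comm_nilpotent.induct)
  case zero
  then show ?case by (simp add: comm_nilpotent_closed comm_nilpotent.zero)
next
  case (comm f)
  note IH = comm.IH
  show ?case
    using comm.prems
  proof (induction rule: comm_nilpotent.induct)
    case zero
    then show ?case using comm.hyps by (simp add: comm_nilpotent.zero)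
  next
    case (comm g)
    have c: "f \<in> carrier R" "g \<in> carrier R"
      using \<open>f \<in> carrier R\<close> comm.hyps by auto
    show ?case
    proof (rule comm_nilpotent.comm)
      fix s assume s: "s \<in> S"
      then have sc: "s \<in> carrier R" using assms(3) by blast
      have "(f \<otimes> g) \<otimes> s \<ominus> s \<otimes> (f \<otimes> g) = f \<otimes> (g \<otimes> s \<ominus> s \<otimes> g) \<oplus> (f \<otimes> s \<ominus> s \<otimes> f) \<otimes> g"
        using c sc by (simp add: a_minus_def l_distr r_distr l_minus r_minus m_assoc a_assoc
            r_neg1)
      \<comment> \<open>The inner induction speaks only of the commutators of \<open>g\<close>; the
        outer hypothesis must be applied to \<open>g\<close> itself.\<close>
      moreover have "g \<in> comm_nilpotent R S"
        using comm.hyps by (rule comm_nilpotent.comm)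
      ultimately show "(f \<otimes> g) \<otimes> s \<ominus> s \<otimes> (f \<otimes> g) \<in> comm_nilpotent R S"
        using IH[OF s] comm.IH[OF s] assms(3) by (simp add: comm_nilpotent_add)
    qed (use c in simp)
  qed
qed

end

text \<open>Commutators of an element of \<open>I\<close> stay in \<open>I\<close>. As long as one
  of them is nonzero, it replaces the element; the induction makes this descent stop at a nonzero
  element whose commutators with \<open>S\<close> all vanish.\<close>

lemma (in ideal) ex_central_comm_nilpotent:
  assumes "f \<in> comm_nilpotent R S" "f \<in> I" "f \<noteq> \<zero>" "S \<subseteq> carrier R"
  shows "\<exists>u\<in>I. u \<noteq> \<zero> \<and> (\<forall>s\<in>S. u \<otimes> s = s \<otimes> u)"
  using assms(1-3)
proof (induction rule: comm_nilpotent.induct)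
  case (comm f)
  show ?case
  proof (cases "\<forall>s\<in>S. f \<otimes> s \<ominus> s \<otimes> f = \<zero>")
    case True
    have "f \<otimes> s = s \<otimes> f" if "s \<in> S" for s
      using True that comm.hyps(1) assms(4) by (metis m_closed r_right_minus_eq subsetD)
    then show ?thesis using comm.prems by blast
  next
    case False
    then obtain s where s: "s \<in> S" "f \<otimes> s \<ominus> s \<otimes> f \<noteq> \<zero>" by blast
    have "f \<otimes> s \<ominus> s \<otimes> f \<in> I"
      using s comm.prems assms(4)
      by (auto simp: a_minus_def I_l_closed I_r_closed)
    then show ?thesis using s by (intro comm.IH)
  qed
qed simp

section \<open>The enveloping algebra\<close>

context poisson_algebra
begin

lemma penv_ring: "ring (penv K P)"
  by (rule assoc_algebra.axioms(2)[OF penv_assoc_algebra])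

lemma PD_ring: "ring (PD K P)"
  by (rule assoc_algebra.axioms(2)[OF PD_assoc_algebra])

lemma penv_alpha_hom_ring: "ring_hom_ring P (penv K P) (penv_alpha K P)"
  using poisson_triple.alpha_hom[OF penv_triple]
  by (intro ring_hom_ringI2 penv_ring P.ring_axioms) (simp add: algebra_hom_def)

lemma penv_pi_hom_ring: "ring_hom_ring (penv K P) (PD K P) (penv_pi K P)"
  using penv_pi_hom by (intro ring_hom_ringI2 penv_ring PD_ring) (simp add: algebra_hom_def)

text \<open>Constants and scalars need no cases, as they lie in the image of \<open>\<alpha>\<close>.\<close>

lemma penv_induct [consumes 1, case_names alpha beta add mult]:
  assumes "u \<in> carrier (penv K P)"
    and "\<And>a. a \<in> carrier P \<Longrightarrow> Q (penv_alpha K P a)"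
    and "\<And>a. a \<in> carrier P \<Longrightarrow> Q (penv_beta K P a)"
    and add: "\<And>u v. \<lbrakk>u \<in> carrier (penv K P); v \<in> carrier (penv K P); Q u; Q v\<rbrakk> \<Longrightarrow>
      Q (u \<oplus>\<^bsub>penv K P\<^esub> v)"
    and mult: "\<And>u v. \<lbrakk>u \<in> carrier (penv K P); v \<in> carrier (penv K P); Q u; Q v\<rbrakk> \<Longrightarrow>
      Q (u \<otimes>\<^bsub>penv K P\<^esub> v)"
  shows "Q u"
proof -
  interpret U: assoc_algebra K "penv K P" by (rule penv_assoc_algebra)
  interpret \<alpha>: ring_hom_ring P "penv K P" "penv_alpha K P" by (rule penv_alpha_hom_ring)
  have Q: "Q (penv_class K P t)" if "t \<in> penv_terms K P" for t
    using that
  proof (induction rule: penv_terms.induct)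
    case 3
    show ?case
      using assms(2)[OF P.M.zero_closed] by (simp add: penv_zero_class)
  next
    case 4
    show ?case
      using assms(2)[OF P.one_closed] by (simp add: penv_one_class)
  next
    case (5 s t)
    then show ?case
      using add[of "penv_class K P s" "penv_class K P t"] by (simp add: penv_class_simps)
  next
    case (6 s t)
    then show ?case
      using mult[of "penv_class K P s" "penv_class K P t"] by (simp add: penv_class_simps)
  next
    case (7 k t)
    let ?t = "penv_class K P t"
    have t: "?t \<in> carrier (penv K P)"
      using 7 by (simp add: penv_carrier)
    have "k \<odot>\<^bsub>penv K P\<^esub> ?t = penv_alpha K P (k \<odot>\<^bsub>P\<^esub> \<one>\<^bsub>P\<^esub>) \<otimes>\<^bsub>penv K P\<^esub> ?t"
      using 7(1) t algebra_homD(5)[OF poisson_triple.alpha_hom[OF penv_triple] 7(1) P.one_closed]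
      by (simp add: U.smult_mult_left)
    then show ?case
      using 7 t mult[of "penv_alpha K P (k \<odot>\<^bsub>P\<^esub> \<one>\<^bsub>P\<^esub>)" ?t] assms(2)
      by (simp add: penv_smult_class)
  qed (use assms in \<open>simp_all add: penv_alpha_def penv_beta_def\<close>)
  show ?thesis
    using assms(1) Q by (auto simp: penv_carrier)
qed

section \<open>Submodules and annihilators\<close>

lemma penv_action_alpha:
  "\<lbrakk>a \<in> carrier P; x \<in> carrier P\<rbrakk> \<Longrightarrow> penv_action K P (penv_alpha K P a) x = a \<otimes>\<^bsub>P\<^esub> x"
  by (simp add: penv_action_def penv_pi_alpha pmul_def)

lemma penv_action_beta:
  "\<lbrakk>a \<in> carrier P; x \<in> carrier P\<rbrakk> \<Longrightarrow> penv_action K P (penv_beta K P a) x = \<lbrace>a, x\<rbrace>\<^bsub>P\<^esub>"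
  by (simp add: penv_action_def penv_pi_beta pad_def)

text \<open>Poisson ideals are submodules: the generators from \<alpha> preserve \<open>J\<close>
  because it is an ideal, those from \<beta> because it is stable under brackets.\<close>

lemma penv_action_poisson_ideal:
  assumes "poisson_ideal J P" "u \<in> carrier (penv K P)" "x \<in> J"
  shows "penv_action K P u x \<in> J"
proof -
  interpret A: left_module "penv K P" P "penv_action K P" by (rule penv_left_module)
  interpret J: ideal J P using assms(1) by (simp add: poisson_ideal_def)
  show ?thesis
    using assms(2,3)
  proof (induction arbitrary: x rule: penv_induct)
    case (alpha a)
    then show ?case by (simp add: penv_action_alpha J.Icarr J.I_l_closed)
  next
    case (beta a)
    then show ?case using assms(1) by (simp add: penv_action_beta J.Icarr poisson_ideal_def)
  next
    case (add u v)
    then show ?case by (simp add: A.act_l_distr J.Icarr J.a_closed)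
  next
    case (mult u v)
    then show ?case by (simp add: A.act_assoc J.Icarr)
  qed
qed

text \<open>For a product with right factor in the annihilator, the left factor has to preserve
  \<open>J\<close>, which is \<open>penv_action_poisson_ideal\<close>; the other side only needs
  that the right factor maps P to P.\<close>

lemma ideal_penv_annihilator:
  assumes "poisson_ideal J P"
  shows "ideal {u \<in> carrier (penv K P). \<forall>x\<in>carrier P. penv_action K P u x \<in> J} (penv K P)"
    (is "ideal ?I _")
proof -
  interpret A: left_module "penv K P" P "penv_action K P" by (rule penv_left_module)
  interpret J: ideal J P using assms by (simp add: poisson_ideal_def)
  interpret \<alpha>: ring_hom_ring P "penv K P" "penv_alpha K P" by (rule penv_alpha_hom_ring)
  have mult: "u \<otimes>\<^bsub>penv K P\<^esub> v \<in> ?I"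
    if "u \<in> carrier (penv K P)" "v \<in> carrier (penv K P)" "u \<in> ?I \<or> v \<in> ?I" for u v
    using that penv_action_poisson_ideal[OF assms]
    by (auto simp: A.act_assoc A.act_closed)
  show ?thesis
  proof (rule idealI[OF penv_ring])
    show "subgroup ?I (add_monoid (penv K P))"
    proof (rule A.A.add.subgroupI)
      \<comment> \<open>Zero is kept in the form \<alpha>(0) so that its action is computed by
        \<open>penv_action_alpha\<close>.\<close>
      have "penv_alpha K P \<zero>\<^bsub>P\<^esub> \<in> ?I"
        by (auto simp: penv_action_alpha simp del: \<alpha>.hom_zero)
      then show "?I \<noteq> {}" by blast
    next
      fix u assume u: "u \<in> ?I"
      have "\<ominus>\<^bsub>penv K P\<^esub> u = (\<ominus>\<^bsub>penv K P\<^esub> \<one>\<^bsub>penv K P\<^esub>) \<otimes>\<^bsub>penv K P\<^esub> u"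
        using u by (simp add: A.A.l_minus)
      also have "\<dots> \<in> ?I" using u by (intro mult) auto
      finally show "\<ominus>\<^bsub>penv K P\<^esub> u \<in> ?I" .
    qed (auto simp: A.act_l_distr)
  qed (use mult in auto)
qed

section \<open>Finite order of the elements of the enveloping algebra\<close>

text \<open>The image of \<alpha> is commutative, so its elements have vanishing commutators; those
  of \<beta>(a) are the \<alpha>({a,b}), one step lower. Sums and products are covered by the
  closure lemmas.\<close>

lemma penv_comm_nilpotent:
  assumes "u \<in> carrier (penv K P)"
  shows "u \<in> comm_nilpotent (penv K P) (penv_alpha K P ` carrier P)" (is "_ \<in> ?N")
proof -
  interpret T: poisson_triple K P "penv K P" "penv_alpha K P" "penv_beta K P" by (rule penv_triple)
  interpret \<alpha>: ring_hom_ring P "penv K P" "penv_alpha K P" by (rule penv_alpha_hom_ring)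
  have alpha: "penv_alpha K P a \<in> ?N" if "a \<in> carrier P" for a
  proof (rule comm_nilpotent.comm)
    fix s assume "s \<in> penv_alpha K P ` carrier P"
    then obtain b where "b \<in> carrier P" "s = penv_alpha K P b" by blast
    then have "penv_alpha K P a \<otimes>\<^bsub>penv K P\<^esub> s \<ominus>\<^bsub>penv K P\<^esub> s \<otimes>\<^bsub>penv K P\<^esub> penv_alpha K P a
        = \<zero>\<^bsub>penv K P\<^esub>"
      using that by (simp flip: \<alpha>.hom_mult add: P.m_comm[of a b])
    then show "penv_alpha K P a \<otimes>\<^bsub>penv K P\<^esub> s \<ominus>\<^bsub>penv K P\<^esub> s \<otimes>\<^bsub>penv K P\<^esub> penv_alpha K P a \<in> ?N"
      by (simp add: comm_nilpotent.zero)
  qed (use that in simp)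
  show ?thesis
    using assms
  proof (induction rule: penv_induct)
    case (beta a)
    show ?case
      by (rule comm_nilpotent.comm)
        (use beta in \<open>auto simp: T.beta_closed T.beta_alpha_comm bracket_closed alpha\<close>)
  next
    case (add u v)
    then show ?case by (intro ring.comm_nilpotent_add[OF penv_ring]) auto
  next
    case (mult u v)
    then show ?case by (intro ring.comm_nilpotent_mult[OF penv_ring]) auto
  qed (rule alpha)
qed

section \<open>Faithfulness, injectivity of \<open>penv_pi\<close> and isomorphism\<close>

lemma penv_pi_extensional:
  assumes "u \<in> carrier (penv K P)"
  shows "penv_pi K P u \<in> extensional (carrier P)"
proof -
  have "penv_pi K P u \<in> carrier (end_algebra K P)"
    using algebra_homD(1)[OF penv_pi_hom assms] PD_subalgebra subringE(1)
    by (auto simp: subalgebra_of_def)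
  then show ?thesis
    by (auto simp: end_algebra_def PiE_def)
qed

lemma penv_pi_eq_zero_iff:
  assumes "u \<in> carrier (penv K P)"
  shows "penv_pi K P u = \<zero>\<^bsub>PD K P\<^esub> \<longleftrightarrow> (\<forall>x\<in>carrier P. penv_action K P u x = \<zero>\<^bsub>P\<^esub>)"
  using penv_pi_extensional[OF assms] unfolding PD_ops penv_action_def
  by (auto intro!: extensionalityI[of _ "carrier P"])

text \<open>Both sides say that the kernel of \<open>penv_pi\<close> is zero, since the elements of
  that kernel are those that annihilate P.\<close>

lemma faithful_iff_inj_penv_pi:
  "faithful_left_module (penv K P) P (penv_action K P) \<longleftrightarrow>
    inj_on (penv_pi K P) (carrier (penv K P))"
proof -
  interpret \<pi>: ring_hom_ring "penv K P" "PD K P" "penv_pi K P" by (rule penv_pi_hom_ring)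
  have "faithful_left_module (penv K P) P (penv_action K P) \<longleftrightarrow>
      (\<forall>u\<in>carrier (penv K P). (\<forall>x\<in>carrier P. penv_action K P u x = \<zero>\<^bsub>P\<^esub>) \<longrightarrow>
        u = \<zero>\<^bsub>penv K P\<^esub>)"
    using penv_left_module
    unfolding faithful_left_module_def faithful_left_module_axioms_def by blast
  also have "\<dots> \<longleftrightarrow>
      (\<forall>u\<in>carrier (penv K P). penv_pi K P u = \<zero>\<^bsub>PD K P\<^esub> \<longrightarrow> u = \<zero>\<^bsub>penv K P\<^esub>)"
    by (simp add: penv_pi_eq_zero_iff)
  also have "\<dots> \<longleftrightarrow> a_kernel (penv K P) (PD K P) (penv_pi K P) = {\<zero>\<^bsub>penv K P\<^esub>}"
    using \<pi>.hom_zero \<pi>.R.zero_closed unfolding a_kernel_def' by blast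
  finally show ?thesis
    by (simp add: \<pi>.inj_iff_trivial_ker)
qed

lemma isomorphic_if_inj_penv_pi:
  assumes "inj_on (penv_pi K P) (carrier (penv K P))"
  shows "isomorphic_algebras K (penv K P) (PD K P)"
  using assms penv_pi_surj penv_pi_hom by (auto simp: isomorphic_algebras_def bij_betw_def)

text \<open>The isomorphism is arbitrary and need not be \<open>penv_pi\<close>, so simplicity is
  transported along it and along its inverse.\<close>

lemma simple_penv_iff_simple_PD:
  assumes "isomorphic_algebras K (penv K P) (PD K P)"
  shows "simple_algebra (penv K P) \<longleftrightarrow> simple_algebra (PD K P)"
proof -
  obtain h where h: "h \<in> ring_iso (penv K P) (PD K P)"
    using assms by (auto simp: isomorphic_algebras_def algebra_hom_def ring_iso_def)
  show ?thesis
    using simple_algebra_ring_iso[OF penv_ring PD_ring h]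
      simple_algebra_ring_iso[OF PD_ring penv_ring ring_iso_set_sym[OF penv_ring h]] by blast
qed

section \<open>Consequences of simplicity of the enveloping algebra\<close>

lemma simple_penv_imp_nonzero:
  assumes "simple_algebra (penv K P)"
  shows "carrier P \<noteq> {\<zero>\<^bsub>P\<^esub>}"
proof
  interpret \<alpha>: ring_hom_ring P "penv K P" "penv_alpha K P" by (rule penv_alpha_hom_ring)
  assume "carrier P = {\<zero>\<^bsub>P\<^esub>}"
  then have "\<one>\<^bsub>P\<^esub> = \<zero>\<^bsub>P\<^esub>" by (metis P.one_closed singletonD)
  then have "\<one>\<^bsub>penv K P\<^esub> = \<zero>\<^bsub>penv K P\<^esub>"
    by (metis \<alpha>.hom_one \<alpha>.hom_zero)
  then show False
    using assms \<alpha>.S.one_zeroD by (simp add: simple_algebra_def)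
qed

lemma simple_penv_imp_inj:
  assumes "simple_algebra (penv K P)"
  shows "inj_on (penv_pi K P) (carrier (penv K P))"
proof (rule ring_hom_ring.simple_algebra_imp_inj[OF penv_pi_hom_ring assms])
  interpret D: ring "PD K P" by (rule PD_ring)
  obtain x where x: "x \<in> carrier P" "x \<noteq> \<zero>\<^bsub>P\<^esub>"
    using simple_penv_imp_nonzero[OF assms] P.M.zero_closed by blast
  then have "\<one>\<^bsub>PD K P\<^esub> x \<noteq> \<zero>\<^bsub>PD K P\<^esub> x"
    by (simp add: PD_ops)
  then show "carrier (PD K P) \<noteq> {\<zero>\<^bsub>PD K P\<^esub>}"
    using D.one_closed by fastforce
qed

lemma simple_penv_imp_poisson_simple:
  assumes "simple_algebra (penv K P)"
  shows "poisson_simple P"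
  unfolding poisson_simple_def
proof (intro conjI allI impI simple_penv_imp_nonzero[OF assms])
  interpret \<alpha>: ring_hom_ring P "penv K P" "penv_alpha K P" by (rule penv_alpha_hom_ring)
  fix J assume J: "poisson_ideal J P"
  interpret J: ideal J P using J by (simp add: poisson_ideal_def)
  let ?I = "{u \<in> carrier (penv K P). \<forall>x\<in>carrier P. penv_action K P u x \<in> J}"
  have "?I = {\<zero>\<^bsub>penv K P\<^esub>} \<or> ?I = carrier (penv K P)"
    using assms ideal_penv_annihilator[OF J] by (auto simp: simple_algebra_def)
  then show "J = {\<zero>\<^bsub>P\<^esub>} \<or> J = carrier P"
  proof
    assume I: "?I = {\<zero>\<^bsub>penv K P\<^esub>}"
    have "a = \<zero>\<^bsub>P\<^esub>" if a: "a \<in> J" for a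
    proof -
      \<comment> \<open>Multiplication by an element of the ideal \<open>J\<close> maps P into
        \<open>J\<close>.\<close>
      have "penv_alpha K P a \<in> ?I"
        using a by (auto simp: penv_action_alpha J.Icarr J.I_r_closed)
      then have "penv_alpha K P a = penv_alpha K P \<zero>\<^bsub>P\<^esub>" using I by simp
      then show ?thesis
        \<comment> \<open>Acting on 1 recovers \<open>a\<close> from \<alpha>(a), so \<alpha> is
          injective.\<close>
        using penv_action_alpha[of a "\<one>\<^bsub>P\<^esub>"] penv_action_alpha[of "\<zero>\<^bsub>P\<^esub>" "\<one>\<^bsub>P\<^esub>"] a
        by (simp add: J.Icarr)
    qed
    then show ?thesis using J.zero_closed by blast
  next
    assume "?I = carrier (penv K P)"
    then have "penv_alpha K P \<one>\<^bsub>P\<^esub> \<in> ?I" by simp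
    then have "penv_action K P (penv_alpha K P \<one>\<^bsub>P\<^esub>) \<one>\<^bsub>P\<^esub> \<in> J"
      using P.one_closed by blast
    then have "\<one>\<^bsub>P\<^esub> \<in> J"
      by (simp add: penv_action_alpha del: \<alpha>.hom_one)
    then show ?thesis using J.one_imp_carrier by blast
  qed
qed

section \<open>From Poisson simplicity to simplicity of the enveloping algebra\<close>

lemma commuting_eq_alpha:
  assumes "inj_on (penv_pi K P) (carrier (penv K P))" "u \<in> carrier (penv K P)"
    and comm: "\<And>x. x \<in> carrier P \<Longrightarrow>
      u \<otimes>\<^bsub>penv K P\<^esub> penv_alpha K P x = penv_alpha K P x \<otimes>\<^bsub>penv K P\<^esub> u"
  shows "u = penv_alpha K P (penv_action K P u \<one>\<^bsub>P\<^esub>)"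
proof -
  interpret A: left_module "penv K P" P "penv_action K P" by (rule penv_left_module)
  interpret \<alpha>: ring_hom_ring P "penv K P" "penv_alpha K P" by (rule penv_alpha_hom_ring)
  define p where "p = penv_action K P u \<one>\<^bsub>P\<^esub>"
  have p: "p \<in> carrier P" using assms(2) by (simp add: A.act_closed p_def)
  have eq: "penv_action K P u x = penv_action K P (penv_alpha K P p) x" if x: "x \<in> carrier P" for x
  proof -
    \<comment> \<open>Writing x as \<alpha>(x) applied to 1 lets \<alpha>(x) be moved past
      \<open>u\<close>, which then acts on 1 only.\<close>
    have "penv_action K P u x = penv_action K P (u \<otimes>\<^bsub>penv K P\<^esub> penv_alpha K P x) \<one>\<^bsub>P\<^esub>"
      using x assms(2) by (simp add: A.act_assoc penv_action_alpha)
    also have "\<dots> = x \<otimes>\<^bsub>P\<^esub> p"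
      using x assms(2) p by (simp add: comm A.act_assoc penv_action_alpha p_def)
    finally show ?thesis
      using x p by (simp add: penv_action_alpha P.m_comm)
  qed
  have "penv_pi K P u = penv_pi K P (penv_alpha K P p)"
    by (rule extensionalityI[OF penv_pi_extensional penv_pi_extensional
          eq[unfolded penv_action_def]])
      (use assms(2) p in simp_all)
  then show ?thesis
    unfolding p_def[symmetric] by (rule inj_onD[OF assms(1)]) (use assms(2) p in simp_all)
qed

text \<open>Stability under brackets comes from \<alpha>({a,x}) = [\<beta>(a), \<alpha>(x)], a
  commutator with an element of the two-sided ideal \<open>I\<close>.\<close>

lemma poisson_ideal_alpha_vimage:
  assumes "ideal I (penv K P)"
  shows "poisson_ideal {a \<in> carrier P. penv_alpha K P a \<in> I} P"
proof -
  interpret T: poisson_triple K P "penv K P" "penv_alpha K P" "penv_beta K P" by (rule penv_triple)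
  interpret \<alpha>: ring_hom_ring P "penv K P" "penv_alpha K P" by (rule penv_alpha_hom_ring)
  interpret I: ideal I "penv K P" by (rule assms)
  have "penv_alpha K P (\<lbrace>a, x\<rbrace>\<^bsub>P\<^esub>) \<in> I"
    if "a \<in> carrier P" "x \<in> carrier P" "penv_alpha K P x \<in> I" for a x
    unfolding T.beta_alpha_comm[OF that(1,2), symmetric] a_minus_def
    using that by (intro I.a_closed I.a_inv_closed I.I_l_closed I.I_r_closed T.beta_closed)
  then show ?thesis
    using \<alpha>.ideal_vimage[OF assms] by (auto simp: poisson_ideal_def bracket_closed)
qed

lemma poisson_simple_imp_simple_penv:
  assumes simple: "poisson_simple P" and inj: "inj_on (penv_pi K P) (carrier (penv K P))"
  shows "simple_algebra (penv K P)"
  unfolding simple_algebra_def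
proof (intro conjI allI impI)
  interpret \<alpha>: ring_hom_ring P "penv K P" "penv_alpha K P" by (rule penv_alpha_hom_ring)
  interpret A: left_module "penv K P" P "penv_action K P" by (rule penv_left_module)
  show "carrier (penv K P) \<noteq> {\<zero>\<^bsub>penv K P\<^esub>}"
  proof
    assume "carrier (penv K P) = {\<zero>\<^bsub>penv K P\<^esub>}"
    \<comment> \<open>As \<alpha> is injective, a zero enveloping algebra would force P to be
      zero.\<close>
    then have eq: "penv_alpha K P a = penv_alpha K P \<zero>\<^bsub>P\<^esub>" if "a \<in> carrier P" for a
      using that \<alpha>.hom_closed by fastforce
    have "a = \<zero>\<^bsub>P\<^esub>" if "a \<in> carrier P" for a
      using penv_action_alpha[OF that P.one_closed]
        penv_action_alpha[OF P.M.zero_closed P.one_closed] eq[OF that] that by simp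
    then have "carrier P = {\<zero>\<^bsub>P\<^esub>}"
      using P.M.zero_closed by blast
    then show False
      using simple by (simp add: poisson_simple_def)
  qed
  fix I assume ideal: "ideal I (penv K P)"
  interpret I: ideal I "penv K P" by (rule ideal)
  show "I = {\<zero>\<^bsub>penv K P\<^esub>} \<or> I = carrier (penv K P)"
  proof (cases "I = {\<zero>\<^bsub>penv K P\<^esub>}")
    case False
    then obtain f where f: "f \<in> I" "f \<noteq> \<zero>\<^bsub>penv K P\<^esub>"
      using I.zero_closed by blast
    have "penv_alpha K P ` carrier P \<subseteq> carrier (penv K P)" by auto
    from I.ex_central_comm_nilpotent[OF penv_comm_nilpotent[OF I.Icarr[OF f(1)]] f this]
    obtain u where u: "u \<in> I" "u \<noteq> \<zero>\<^bsub>penv K P\<^esub>"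
      "\<forall>s\<in>penv_alpha K P ` carrier P. u \<otimes>\<^bsub>penv K P\<^esub> s = s \<otimes>\<^bsub>penv K P\<^esub> u"
      by blast
    let ?p = "penv_action K P u \<one>\<^bsub>P\<^esub>" and ?J = "{a \<in> carrier P. penv_alpha K P a \<in> I}"
    have p: "penv_alpha K P ?p = u" "?p \<in> carrier P"
      using commuting_eq_alpha[OF inj, of u] u I.Icarr by (auto simp: A.act_closed)
    have "?p \<in> ?J" using p u(1) by (metis (mono_tags, lifting) mem_Collect_eq)
    \<comment> \<open>A nonzero element of the Poisson ideal \<open>?J\<close> excludes the first
      alternative of Poisson simplicity.\<close>
    moreover have "?p \<noteq> \<zero>\<^bsub>P\<^esub>" using p(1) u(2) \<alpha>.hom_zero by metis
    ultimately have "?J = carrier P"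
      using simple poisson_ideal_alpha_vimage[OF ideal] unfolding poisson_simple_def by blast
    then have "\<one>\<^bsub>penv K P\<^esub> \<in> I"
      using P.one_closed \<alpha>.hom_one by (metis (mono_tags, lifting) mem_Collect_eq)
    then show ?thesis using I.one_imp_carrier by blast
  qed simp
qed

end

theorem theorem1p2:
  fixes K :: "('k, 'm) ring_scheme" and P :: "('k, 'p, 'n) poisson_scheme"
  assumes "poisson_algebra K P"
  shows
    "(simple_algebra (penv K P) \<longleftrightarrow>
        simple_algebra (PD K P) \<and> isomorphic_algebras K (penv K P) (PD K P)) \<and>
     (simple_algebra (penv K P) \<longleftrightarrow>
        poisson_simple P \<and> faithful_left_module (penv K P) P (penv_action K P)) \<and>
     (simple_algebra (penv K P) \<or>
      simple_algebra (PD K P) \<and> isomorphic_algebras K (penv K P) (PD K P) \<or>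
      poisson_simple P \<and> faithful_left_module (penv K P) P (penv_action K P) \<longrightarrow>
        isomorphic_algebras K (penv K P) (PD K P))"
proof -
  interpret poisson_algebra K P by (rule assms)
  show ?thesis
    \<comment> \<open>The conditions meet in the injectivity of \<open>penv_pi\<close>: simplicity
      of the enveloping algebra implies it, faithfulness is equivalent to it, and it yields the
      isomorphism.\<close>
    using simple_penv_iff_simple_PD isomorphic_if_inj_penv_pi simple_penv_imp_inj
      simple_penv_imp_poisson_simple poisson_simple_imp_simple_penv faithful_iff_inj_penv_pi
    by blast
qed

end
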